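(* Let $\Gamma$, $V$, $T$, $\Upsilon$, $\Psi$ be as in the context, and let $\pi$ be either of the two $\mathbb{C}$-algebra homomorphisms $U_q(\mathfrak{sl}_2)\to T$ described in the context, with image $\mathcal{U}$. Then $T$ is generated as an algebra by $\mathcal{U}$ together with $\Upsilon^{\pm1},\Psi^{\pm1}$.
   Context: Let $b$ be a prime power, $D\ge3$ an integer, and $U$ a finite-dimensional vector space over $\mathbb{F}_b$ with one of the following nondegenerate forms, with attached number $e$: symplectic, $\dim U=2D$ ($e=1$); quadratic, $\dim U=2D+1$ ($e=1$); quadratic of Witt index $D$, $\dim U=2D$ ($e=0$); quadratic of Witt index $D$, $\dim U=2D+2$ ($e=2$); Hermitean, $\dim U=2D+1$, $b$ a square ($e=3/2$); Hermitean, $\dim U=2D$, $b$ a square ($e=1/2$). The dual polar graph $\Gamma$ has vertex set $X$ = maximal isotropic subspaces, $y\sim z$ iff $\dim(y\cap z)=D-1$, $\partial(y,z)=D-\dim(y\cap z)$. Let $q=\sqrt b>0$. $V=\mathbb{C}^X$, $A$ the adjacency matrix, $\theta_0>\dots>\theta_D$ its eigenvalues, $E_i$ the orthogonal projection onto the $\theta_i$-eigenspace. Fix $x\in X$; $E^*_i$ diagonal with $(y,y)$-entry $1$ if $\partial(x,y)=i$, else $0$; $A^*$ diagonal with $(y,y)$-entry $|X|(E_1)_{xy}$; $T$ the algebra generated by $A,A^*$. For an irreducible $T$-module $W$: $r=\min\{i:E^*_iW\ne0\}$, $t=\min\{i:E_iW\ne0\}$, $d=|\{i:E^*_iW\ne0\}|-1$.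 $\Upsilon$ (resp. $\Psi$) is the central element of $T$ acting on the span of irreducible $T$-modules with $r+t+d-D=\mu$ (resp. $r-t=\nu$) as $q^\mu I$ (resp. $q^\nu I$). $U_q(\mathfrak{sl}_2)$ has generators $x,y,z^{\pm1}$ and relations $zz^{-1}=z^{-1}z=1$, $\frac{qxy-q^{-1}yx}{q-q^{-1}}=\frac{qyz-q^{-1}zy}{q-q^{-1}}=\frac{qzx-q^{-1}xz}{q-q^{-1}}=1$. Put $h=\frac{1-q^{2e}}{q^2-1}$, $h^*=\zeta=-\frac{b(b^{D+e-2}+1)}{b-1}$, $\kappa=\frac{q^{2e+D}}{q^2-1}$, $\kappa^*=\xi q^{-D}$ with $\xi=\frac{b^2(b^{D+e-2}+1)(b^{D+e-1}+1)}{(b-1)(b^e+b)}$, $\upsilon=-\frac{q^D}{q^2-1}$. There is a unique $U_q(\mathfrak{sl}_2)$-module structure on $V$ with $A=h1+\kappa\Upsilon^{-1}\Psi x+\upsilon\Upsilon\Psi^{-1}y$, $A^*=h^*1+\kappa^*\Upsilon^{-1}\Psi^{-1}z$, and a unique one with $A=h1+\kappa\Upsilon^{-1}\Psi y+\upsilon\Upsilon\Psi^{-1}x$, $A^*=h^*1+\kappa^*\Upsilon^{-1}\Psi^{-1}z$; each induces an algebra homomorphism $U_q(\mathfrak{sl}_2)\to\mathrm{End}(V)$ whose image lies in $T$. These are the two homomorphisms $U_q(\mathfrak{sl}_2)\to T$. *)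

theory Defs
  imports
    Complex_Main
    "HOL-Library.Cardinality"
    "HOL-Library.Function_Algebras"
    "HOL-Library.Poly_Mapping"
    "HOL-Algebra.Module"
    "HOL-Algebra.QuotRing"
begin


section \<open>Polar spaces\<close>

datatype ('k, 'u) form =
    Symplectic "'u \<Rightarrow> 'u \<Rightarrow> 'k"
  | Quadratic "'u \<Rightarrow> 'k"
  | Hermitean "'u \<Rightarrow> 'u \<Rightarrow> 'k"

definition bilinear_form ::
  "('k::field \<Rightarrow> 'u::ab_group_add \<Rightarrow> 'u) \<Rightarrow> ('u \<Rightarrow> 'u \<Rightarrow> 'k) \<Rightarrow> bool" where
  "bilinear_form scale f \<longleftrightarrow>
     (\<forall>v. Vector_Spaces.linear scale (*) (\<lambda>u. f u v)) \<and>
     (\<forall>u. Vector_Spaces.linear scale (*) (\<lambda>v. f u v))"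

definition polarization :: "('u::ab_group_add \<Rightarrow> 'k::field) \<Rightarrow> 'u \<Rightarrow> 'u \<Rightarrow> 'k" where
  "polarization Q u v = Q (u + v) - Q u - Q v"

text \<open>
  In the quadratic case the condition is that \<open>Q\<close> has no nonzero singular vector in the radical
  of its polarization; in characteristic 2 and odd dimension that radical is never zero.
  A Hermitean form is taken with respect to the involution \<open>a \<mapsto> a ^ s\<close>, where \<open>s\<^sup>2\<close> is the order of
  the field; its semilinearity in the second argument follows from the other two conditions.
\<close>

fun nondegenerate_form ::
  "('k::{field,finite} \<Rightarrow> 'u::ab_group_add \<Rightarrow> 'u) \<Rightarrow> ('k, 'u) form \<Rightarrow> bool" where
  "nondegenerate_form scale (Symplectic f) \<longleftrightarrow>
     bilinear_form scale f \<and> (\<forall>u. f u u = 0) \<and> (\<forall>u. (\<forall>v. f u v = 0) \<longrightarrow> u = 0)"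
| "nondegenerate_form scale (Quadratic Q) \<longleftrightarrow>
     (\<forall>a u. Q (scale a u) = a\<^sup>2 * Q u) \<and> bilinear_form scale (polarization Q) \<and>
     (\<forall>u. Q u = 0 \<and> (\<forall>v. polarization Q u v = 0) \<longrightarrow> u = 0)"
| "nondegenerate_form scale (Hermitean f) \<longleftrightarrow>
     (\<exists>s. CARD('k) = s\<^sup>2 \<and>
        (\<forall>v. Vector_Spaces.linear scale (*) (\<lambda>u. f u v)) \<and>
        (\<forall>u v. f v u = f u v ^ s) \<and>
        (\<forall>u. (\<forall>v. f u v = 0) \<longrightarrow> u = 0))"

fun vanishes_on :: "('k::zero, 'u) form \<Rightarrow> 'u set \<Rightarrow> bool" where
  "vanishes_on (Symplectic f) W \<longleftrightarrow> (\<forall>u\<in>W. \<forall>v\<in>W. f u v = 0)"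
| "vanishes_on (Quadratic Q) W \<longleftrightarrow> (\<forall>u\<in>W. Q u = 0)"
| "vanishes_on (Hermitean f) W \<longleftrightarrow> (\<forall>u\<in>W. \<forall>v\<in>W. f u v = 0)"

definition isotropic_subspaces ::
  "('k::field \<Rightarrow> 'u::ab_group_add \<Rightarrow> 'u) \<Rightarrow> ('k, 'u) form \<Rightarrow> 'u set set" where
  "isotropic_subspaces scale \<phi> = {W. module.subspace scale W \<and> vanishes_on \<phi> W}"

definition witt_index ::
  "('k::field \<Rightarrow> 'u::ab_group_add \<Rightarrow> 'u) \<Rightarrow> ('k, 'u) form \<Rightarrow> nat" where
  "witt_index scale \<phi> = Max (vector_space.dim scale ` isotropic_subspaces scale \<phi>)"

fun polar_type ::
  "('k::field \<Rightarrow> 'u::ab_group_add \<Rightarrow> 'u) \<Rightarrow> ('k, 'u) form \<Rightarrow> nat \<Rightarrow> real \<Rightarrow> bool" where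
  "polar_type scale (Symplectic f) D e \<longleftrightarrow>
     vector_space.dim scale (UNIV :: 'u set) = 2 * D \<and> e = 1"
| "polar_type scale (Quadratic Q) D e \<longleftrightarrow>
     vector_space.dim scale (UNIV :: 'u set) = 2 * D + 1 \<and> e = 1 \<or>
     vector_space.dim scale (UNIV :: 'u set) = 2 * D \<and>
       witt_index scale (Quadratic Q) = D \<and> e = 0 \<or>
     vector_space.dim scale (UNIV :: 'u set) = 2 * D + 2 \<and>
       witt_index scale (Quadratic Q) = D \<and> e = 2"
| "polar_type scale (Hermitean f) D e \<longleftrightarrow>
     vector_space.dim scale (UNIV :: 'u set) = 2 * D + 1 \<and> e = 3 / 2 \<or>
     vector_space.dim scale (UNIV :: 'u set) = 2 * D \<and> e = 1 / 2"

definition polar_space ::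
  "('k::{field,finite} \<Rightarrow> 'u::ab_group_add \<Rightarrow> 'u) \<Rightarrow> ('k, 'u) form \<Rightarrow> nat \<Rightarrow> real \<Rightarrow> bool" where
  "polar_space scale \<phi> D e \<longleftrightarrow>
     vector_space scale \<and> (\<exists>B. finite B \<and> module.span scale B = UNIV) \<and>
     nondegenerate_form scale \<phi> \<and> polar_type scale \<phi> D e"

definition dp_vertices ::
  "('k::field \<Rightarrow> 'u::ab_group_add \<Rightarrow> 'u) \<Rightarrow> ('k, 'u) form \<Rightarrow> 'u set set" where
  "dp_vertices scale \<phi> =
     {W \<in> isotropic_subspaces scale \<phi>. \<forall>W'\<in>isotropic_subspaces scale \<phi>. W \<subseteq> W' \<longrightarrow> W' = W}"

definition dp_dist ::
  "('k::field \<Rightarrow> 'u::ab_group_add \<Rightarrow> 'u) \<Rightarrow> nat \<Rightarrow> 'u set \<Rightarrow> 'u set \<Rightarrow> nat" where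
  "dp_dist scale D y z = D - vector_space.dim scale (y \<inter> z)"


section \<open>Vectors and matrices indexed by a finite set\<close>

text \<open>
  \<open>\<complex>\<^sup>X\<close> consists of the functions vanishing off \<open>X\<close>, and \<open>End (\<complex>\<^sup>X)\<close> of the matrices vanishing
  off \<open>X \<times> X\<close>. Complex algebras are represented by records of type \<open>module\<close>, which extends \<open>ring\<close>
  by a scalar multiplication.
\<close>

type_synonym 'x cvec = "'x \<Rightarrow> complex"
type_synonym 'x cmat = "'x \<Rightarrow> 'x \<Rightarrow> complex"

definition vscale :: "complex \<Rightarrow> 'x cvec \<Rightarrow> 'x cvec" where
  "vscale c v = (\<lambda>y. c * v y)"

definition vecs :: "'x set \<Rightarrow> 'x cvec set" where
  "vecs X = {v. \<forall>y. y \<notin> X \<longrightarrow> v y = 0}"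

definition cinner :: "'x set \<Rightarrow> 'x cvec \<Rightarrow> 'x cvec \<Rightarrow> complex" where
  "cinner X v w = (\<Sum>y\<in>X. v y * cnj (w y))"

definition End_alg :: "'x set \<Rightarrow> (complex, 'x cmat) module" where
  "End_alg X =
     \<lparr>carrier = {M. \<forall>y z. \<not> (y \<in> X \<and> z \<in> X) \<longrightarrow> M y z = 0},
      mult = (\<lambda>M N y z. \<Sum>w\<in>X. M y w * N w z),
      one = (\<lambda>y z. if y = z \<and> y \<in> X then 1 else 0),
      zero = (\<lambda>y z. 0),
      add = (\<lambda>M N y z. M y z + N y z),
      smult = (\<lambda>c M y z. c * M y z)\<rparr>"

definition apply_mat :: "'x set \<Rightarrow> 'x cmat \<Rightarrow> 'x cvec \<Rightarrow> 'x cvec" where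
  "apply_mat X M v = (\<lambda>y. \<Sum>z\<in>X. M y z * v z)"

definition eigenspace :: "'x set \<Rightarrow> 'x cmat \<Rightarrow> complex \<Rightarrow> 'x cvec set" where
  "eigenspace X M c = {v \<in> vecs X. apply_mat X M v = vscale c v}"

definition orth_projection :: "'x set \<Rightarrow> 'x cvec set \<Rightarrow> 'x cmat" where
  "orth_projection X S =
     (THE P. P \<in> carrier (End_alg X) \<and>
        (\<forall>v\<in>S. apply_mat X P v = v) \<and>
        (\<forall>v\<in>vecs X. (\<forall>w\<in>S. cinner X v w = 0) \<longrightarrow> apply_mat X P v = 0))"

definition complex_subalgebra :: "(complex, 'a, 'm) module_scheme \<Rightarrow> 'a set \<Rightarrow> bool" where
  "complex_subalgebra R K \<longleftrightarrow>
     K \<subseteq> carrier R \<and> \<one>\<^bsub>R\<^esub> \<in> K \<and>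
     (\<forall>a\<in>K. \<forall>b\<in>K. a \<oplus>\<^bsub>R\<^esub> b \<in> K) \<and>
     (\<forall>a\<in>K. \<forall>b\<in>K. a \<otimes>\<^bsub>R\<^esub> b \<in> K) \<and>
     (\<forall>c. \<forall>a\<in>K. c \<odot>\<^bsub>R\<^esub> a \<in> K)"

definition generated_algebra :: "(complex, 'a, 'm) module_scheme \<Rightarrow> 'a set \<Rightarrow> 'a set" where
  "generated_algebra R S = (complex_subalgebra R) hull S"

definition complex_alg_hom ::
  "(complex, 'a, 'm) module_scheme \<Rightarrow> (complex, 'b, 'n) module_scheme \<Rightarrow> ('a \<Rightarrow> 'b) set" where
  "complex_alg_hom R S =
     {f \<in> ring_hom R S. \<forall>c. \<forall>a\<in>carrier R. f (c \<odot>\<^bsub>R\<^esub> a) = c \<odot>\<^bsub>S\<^esub> f a}"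

definition submodule_of :: "'x set \<Rightarrow> 'x cmat set \<Rightarrow> 'x cvec set \<Rightarrow> bool" where
  "submodule_of X T W \<longleftrightarrow>
     W \<subseteq> vecs X \<and> module.subspace vscale W \<and> (\<forall>B\<in>T. \<forall>w\<in>W. apply_mat X B w \<in> W)"

definition irreducible_module :: "'x set \<Rightarrow> 'x cmat set \<Rightarrow> 'x cvec set \<Rightarrow> bool" where
  "irreducible_module X T W \<longleftrightarrow>
     submodule_of X T W \<and> W \<noteq> {0} \<and>
     (\<forall>W'. submodule_of X T W' \<and> W' \<subseteq> W \<longrightarrow> W' = {0} \<or> W' = W)"


section \<open>The dual polar graph and its subconstituent algebra\<close>

definition dp_adj ::
  "('k::field \<Rightarrow> 'u::ab_group_add \<Rightarrow> 'u) \<Rightarrow> ('k, 'u) form \<Rightarrow> nat \<Rightarrow> 'u set cmat" where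
  "dp_adj scale \<phi> D =
     (\<lambda>y z. if y \<in> dp_vertices scale \<phi> \<and> z \<in> dp_vertices scale \<phi> \<and>
               vector_space.dim scale (y \<inter> z) = D - 1
            then 1 else 0)"

text \<open>The eigenvalues of the real symmetric matrix \<open>dp_adj\<close> are real; they are listed decreasingly.\<close>

definition dp_theta ::
  "('k::field \<Rightarrow> 'u::ab_group_add \<Rightarrow> 'u) \<Rightarrow> ('k, 'u) form \<Rightarrow> nat \<Rightarrow> nat \<Rightarrow> real" where
  "dp_theta scale \<phi> D i =
     rev (sorted_list_of_set
       {c::real. eigenspace (dp_vertices scale \<phi>) (dp_adj scale \<phi> D) (complex_of_real c) \<noteq> {0}}) ! i"

definition dp_E ::
  "('k::field \<Rightarrow> 'u::ab_group_add \<Rightarrow> 'u) \<Rightarrow> ('k, 'u) form \<Rightarrow> nat \<Rightarrow> nat \<Rightarrow> 'u set cmat" where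
  "dp_E scale \<phi> D i =
     orth_projection (dp_vertices scale \<phi>)
       (eigenspace (dp_vertices scale \<phi>) (dp_adj scale \<phi> D)
         (complex_of_real (dp_theta scale \<phi> D i)))"

definition dp_Estar ::
  "('k::field \<Rightarrow> 'u::ab_group_add \<Rightarrow> 'u) \<Rightarrow> ('k, 'u) form \<Rightarrow> nat \<Rightarrow> 'u set \<Rightarrow> nat \<Rightarrow> 'u set cmat"
  where
  "dp_Estar scale \<phi> D x i =
     (\<lambda>y z. if y = z \<and> y \<in> dp_vertices scale \<phi> \<and> dp_dist scale D x y = i then 1 else 0)"

definition dp_adj_dual ::
  "('k::field \<Rightarrow> 'u::ab_group_add \<Rightarrow> 'u) \<Rightarrow> ('k, 'u) form \<Rightarrow> nat \<Rightarrow> 'u set \<Rightarrow> 'u set cmat" where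
  "dp_adj_dual scale \<phi> D x =
     (\<lambda>y z. if y = z \<and> y \<in> dp_vertices scale \<phi>
            then of_nat (card (dp_vertices scale \<phi>)) * dp_E scale \<phi> D 1 x y else 0)"

definition dp_T ::
  "('k::field \<Rightarrow> 'u::ab_group_add \<Rightarrow> 'u) \<Rightarrow> ('k, 'u) form \<Rightarrow> nat \<Rightarrow> 'u set \<Rightarrow> 'u set cmat set" where
  "dp_T scale \<phi> D x =
     generated_algebra (End_alg (dp_vertices scale \<phi>)) {dp_adj scale \<phi> D, dp_adj_dual scale \<phi> D x}"

definition dp_endpoint ::
  "('k::field \<Rightarrow> 'u::ab_group_add \<Rightarrow> 'u) \<Rightarrow> ('k, 'u) form \<Rightarrow> nat \<Rightarrow> 'u set \<Rightarrow> 'u set cvec set \<Rightarrow> nat"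
  where
  "dp_endpoint scale \<phi> D x W =
     Min {i. i \<le> D \<and> apply_mat (dp_vertices scale \<phi>) (dp_Estar scale \<phi> D x i) ` W \<noteq> {0}}"

definition dp_dual_endpoint ::
  "('k::field \<Rightarrow> 'u::ab_group_add \<Rightarrow> 'u) \<Rightarrow> ('k, 'u) form \<Rightarrow> nat \<Rightarrow> 'u set cvec set \<Rightarrow> nat" where
  "dp_dual_endpoint scale \<phi> D W =
     Min {i. i \<le> D \<and> apply_mat (dp_vertices scale \<phi>) (dp_E scale \<phi> D i) ` W \<noteq> {0}}"

definition dp_diameter ::
  "('k::field \<Rightarrow> 'u::ab_group_add \<Rightarrow> 'u) \<Rightarrow> ('k, 'u) form \<Rightarrow> nat \<Rightarrow> 'u set \<Rightarrow> 'u set cvec set \<Rightarrow> int"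
  where
  "dp_diameter scale \<phi> D x W =
     int (card {i. i \<le> D \<and> apply_mat (dp_vertices scale \<phi>) (dp_Estar scale \<phi> D x i) ` W \<noteq> {0}}) - 1"

text \<open>
  The central element of the algebra \<open>T\<close> acting as \<open>q\<^sup>n\<close> on the span of the irreducible
  \<open>T\<close>-modules \<open>W\<close> with \<open>f W = n\<close>, for every integer \<open>n\<close>.
\<close>

definition central_q_power ::
  "'x set \<Rightarrow> 'x cmat set \<Rightarrow> complex \<Rightarrow> ('x cvec set \<Rightarrow> int) \<Rightarrow> 'x cmat \<Rightarrow> bool" where
  "central_q_power X T q f C \<longleftrightarrow>
     C \<in> T \<and> (\<forall>B\<in>T. C \<otimes>\<^bsub>End_alg X\<^esub> B = B \<otimes>\<^bsub>End_alg X\<^esub> C) \<and>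
     (\<forall>n. \<forall>v\<in>module.span vscale (\<Union>{W. irreducible_module X T W \<and> f W = n}).
        apply_mat X C v = vscale (q powi n) v)"

definition is_Upsilon ::
  "('k::field \<Rightarrow> 'u::ab_group_add \<Rightarrow> 'u) \<Rightarrow> ('k, 'u) form \<Rightarrow> nat \<Rightarrow> 'u set \<Rightarrow> complex \<Rightarrow>
   'u set cmat \<Rightarrow> bool" where
  "is_Upsilon scale \<phi> D x q =
     central_q_power (dp_vertices scale \<phi>) (dp_T scale \<phi> D x) q
       (\<lambda>W. int (dp_endpoint scale \<phi> D x W) + int (dp_dual_endpoint scale \<phi> D W)
            + dp_diameter scale \<phi> D x W - int D)"

definition is_Psi ::
  "('k::field \<Rightarrow> 'u::ab_group_add \<Rightarrow> 'u) \<Rightarrow> ('k, 'u) form \<Rightarrow> nat \<Rightarrow> 'u set \<Rightarrow> complex \<Rightarrow>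
   'u set cmat \<Rightarrow> bool" where
  "is_Psi scale \<phi> D x q =
     central_q_power (dp_vertices scale \<phi>) (dp_T scale \<phi> D x) q
       (\<lambda>W. int (dp_endpoint scale \<phi> D x W) - int (dp_dual_endpoint scale \<phi> D W))"


section \<open>The equitable presentation of the quantum algebra of sl(2)\<close>

text \<open>Lists form the free monoid, so \<open>gen list \<Rightarrow>\<^sub>0 complex\<close> is the free algebra on \<open>gen\<close>.\<close>

instantiation list :: (type) monoid_add
begin

definition zero_list :: "'a list" where
  "zero_list = []"

definition plus_list :: "'a list \<Rightarrow> 'a list \<Rightarrow> 'a list" where
  "plus_list xs ys = xs @ ys"

instance
  by standard (simp_all add: zero_list_def plus_list_def)

end

datatype uq_gen = GX | GY | GZ | GZinv

type_synonym uq_free = "uq_gen list \<Rightarrow>\<^sub>0 complex"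

definition scalar :: "complex \<Rightarrow> uq_free" where
  "scalar c = Poly_Mapping.single [] c"

definition gen :: "uq_gen \<Rightarrow> uq_free" where
  "gen g = Poly_Mapping.single [g] 1"

definition free_alg :: "(complex, uq_free) module" where
  "free_alg =
     \<lparr>carrier = UNIV, mult = (*), one = 1, zero = 0, add = (+), smult = (\<lambda>c a. scalar c * a)\<rparr>"

definition q_weyl :: "complex \<Rightarrow> uq_free \<Rightarrow> uq_free \<Rightarrow> uq_free" where
  "q_weyl q a b =
     scalar (1 / (q - inverse q)) * (scalar q * a * b - scalar (inverse q) * b * a) - 1"

definition uq_ideal :: "complex \<Rightarrow> uq_free set" where
  "uq_ideal q =
     Idl\<^bsub>free_alg\<^esub>
       {gen GZ * gen GZinv - 1, gen GZinv * gen GZ - 1,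
        q_weyl q (gen GX) (gen GY), q_weyl q (gen GY) (gen GZ), q_weyl q (gen GZ) (gen GX)}"

definition uq_coset :: "complex \<Rightarrow> uq_free \<Rightarrow> uq_free set" where
  "uq_coset q a = uq_ideal q +>\<^bsub>free_alg\<^esub> a"

definition uq :: "complex \<Rightarrow> (complex, uq_free set) module" where
  "uq q = ring.extend (free_alg Quot uq_ideal q)
     (module.fields (\<lambda>c C. \<Union>a\<in>C. uq_coset q (c \<odot>\<^bsub>free_alg\<^esub> a)))"

definition uq_x :: "complex \<Rightarrow> uq_free set" where "uq_x q = uq_coset q (gen GX)"
definition uq_y :: "complex \<Rightarrow> uq_free set" where "uq_y q = uq_coset q (gen GY)"
definition uq_z :: "complex \<Rightarrow> uq_free set" where "uq_z q = uq_coset q (gen GZ)"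


section \<open>The two homomorphisms\<close>

definition coef_h :: "real \<Rightarrow> real \<Rightarrow> real" where
  "coef_h b e = (let q = sqrt b in (1 - q powr (2 * e)) / (q\<^sup>2 - 1))"

definition coef_hstar :: "real \<Rightarrow> nat \<Rightarrow> real \<Rightarrow> real" where
  "coef_hstar b D e = - (b * (b powr (real D + e - 2) + 1) / (b - 1))"

definition coef_kappa :: "real \<Rightarrow> nat \<Rightarrow> real \<Rightarrow> real" where
  "coef_kappa b D e = (let q = sqrt b in q powr (2 * e + real D) / (q\<^sup>2 - 1))"

definition coef_xi :: "real \<Rightarrow> nat \<Rightarrow> real \<Rightarrow> real" where
  "coef_xi b D e =
     b\<^sup>2 * (b powr (real D + e - 2) + 1) * (b powr (real D + e - 1) + 1)
       / ((b - 1) * (b powr e + b))"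

definition coef_kappastar :: "real \<Rightarrow> nat \<Rightarrow> real \<Rightarrow> real" where
  "coef_kappastar b D e = coef_xi b D e * sqrt b powi (- int D)"

definition coef_upsilon :: "real \<Rightarrow> nat \<Rightarrow> real" where
  "coef_upsilon b D = (let q = sqrt b in - (q ^ D / (q\<^sup>2 - 1)))"

text \<open>
  With \<open>(g1, g2) = (x, y)\<close> resp. \<open>(g1, g2) = (y, x)\<close> this describes the first resp. second
  homomorphism, i.e. the action of \<open>U\<^sub>q\<close> on \<open>\<complex>\<^sup>X\<close> with
  \<open>A = h 1 + \<kappa> \<Upsilon>\<^sup>-\<^sup>1 \<Psi> g1 + \<upsilon> \<Upsilon> \<Psi>\<^sup>-\<^sup>1 g2\<close> and \<open>A\<^sup>* = h\<^sup>* 1 + \<kappa>\<^sup>* \<Upsilon>\<^sup>-\<^sup>1 \<Psi>\<^sup>-\<^sup>1 z\<close>.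
\<close>

definition dp_hom ::
  "('k::{field,finite} \<Rightarrow> 'u::ab_group_add \<Rightarrow> 'u) \<Rightarrow> ('k, 'u) form \<Rightarrow> nat \<Rightarrow> real \<Rightarrow> 'u set \<Rightarrow>
   'u set cmat \<Rightarrow> 'u set cmat \<Rightarrow> uq_free set \<Rightarrow> uq_free set \<Rightarrow> (uq_free set \<Rightarrow> 'u set cmat) \<Rightarrow> bool"
  where
  "dp_hom scale \<phi> D e x \<Upsilon> \<Psi> g1 g2 \<pi> \<longleftrightarrow>
     (let b = real CARD('k); q = complex_of_real (sqrt b); R = End_alg (dp_vertices scale \<phi>) in
      \<pi> \<in> complex_alg_hom (uq q) R \<and>
      dp_adj scale \<phi> D =
        of_real (coef_h b e) \<odot>\<^bsub>R\<^esub> \<one>\<^bsub>R\<^esub>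
        \<oplus>\<^bsub>R\<^esub> of_real (coef_kappa b D e) \<odot>\<^bsub>R\<^esub> (inv\<^bsub>R\<^esub> \<Upsilon> \<otimes>\<^bsub>R\<^esub> \<Psi> \<otimes>\<^bsub>R\<^esub> \<pi> g1)
        \<oplus>\<^bsub>R\<^esub> of_real (coef_upsilon b D) \<odot>\<^bsub>R\<^esub> (\<Upsilon> \<otimes>\<^bsub>R\<^esub> inv\<^bsub>R\<^esub> \<Psi> \<otimes>\<^bsub>R\<^esub> \<pi> g2) \<and>
      dp_adj_dual scale \<phi> D x =
        of_real (coef_hstar b D e) \<odot>\<^bsub>R\<^esub> \<one>\<^bsub>R\<^esub>
        \<oplus>\<^bsub>R\<^esub> of_real (coef_kappastar b D e) \<odot>\<^bsub>R\<^esub> (inv\<^bsub>R\<^esub> \<Upsilon> \<otimes>\<^bsub>R\<^esub> inv\<^bsub>R\<^esub> \<Psi> \<otimes>\<^bsub>R\<^esub> \<pi> (uq_z q)))"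

end

theory Submission
  imports Defs
begin

text \<open>
  The formulas for \<open>A\<close> and \<open>A\<^sup>*\<close> put both into the algebra generated by the image of \<open>\<pi>\<close> and
  \<open>\<Upsilon>\<^sup>\<plusminus>\<^sup>1\<close>, \<open>\<Psi>\<^sup>\<plusminus>\<^sup>1\<close>. Conversely, a central element acting on every irreducible module as a nonzero
  scalar is injective, and in a finite-dimensional algebra an injective element is invertible, so
  \<open>\<Upsilon>\<^sup>\<plusminus>\<^sup>1\<close> and \<open>\<Psi>\<^sup>\<plusminus>\<^sup>1\<close> lie in \<open>T\<close>. The formula for \<open>A\<^sup>*\<close> then gives \<open>\<pi>(z) \<in> T\<close>, hence
  \<open>\<pi>(z)\<inverse> \<in> T\<close>. Finally \<open>A - h 1\<close> is, up to a multiple of \<open>\<pi>(z)\<inverse>\<close> by an element of \<open>T\<close>, a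
  combination of \<open>\<pi>(x) - \<pi>(z)\<inverse>\<close> and \<open>\<pi>(y) - \<pi>(z)\<inverse>\<close>, which are eigenvectors of conjugation by \<open>\<pi>(z)\<close>
  with distinct eigenvalues; so both of them lie in \<open>T\<close>.
\<close>

section \<open>Finite-dimensional subspaces\<close>

context vector_space
begin

text \<open>A basis of \<open>U\<close> stays independent when a vector of \<open>V\<close> outside
  \<open>U\<close> is added to it. The function types used below may be infinite-dimensional, so
  finite dimension enters through a finite \<open>F\<close> whose span contains
  \<open>V\<close>.\<close>

lemma dim_strict_mono_subspace:
  assumes "finite F" "V \<subseteq> span F" "subspace U" "U \<subseteq> V" "U \<noteq> V"
  shows "dim U < dim V"
proof -
  obtain B where B: "B \<subseteq> U" "independent B" "U \<subseteq> span B" "card B = dim U"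
    using basis_exists[of U] by blast
  obtain C where C: "C \<subseteq> V" "independent C" "V \<subseteq> span C" "card C = dim V"
    using basis_exists[of V] by blast
  have finC: "finite C"
    using independent_span_bound[OF assms(1) C(2)] C(1) assms(2) by blast
  obtain v where v: "v \<in> V" "v \<notin> U"
    using assms(4,5) by blast
  have "span B \<subseteq> U"
    using B(1) assms(3) by (rule span_minimal)
  with v have "v \<notin> span B" by blast
  then have "independent (insert v B)"
    using B(2) by (rule independent_insertI)
  moreover have "insert v B \<subseteq> span C"
    using v B(1) assms(4) C(3) by blast
  ultimately have "finite (insert v B) \<and> card (insert v B) \<le> card C"
    by (rule independent_span_bound[OF finC])
  moreover have "v \<notin> B"
    using B(1) v by blast
  ultimately have "Suc (card B) \<le> card C"
    by auto
  then show ?thesis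
    using B(4) C(4) by simp
qed

text \<open>By induction on \<open>B\<close>: a vector in the span of \<open>insert a B\<close> is a
  multiple of \<open>a\<close> plus a vector in the span of \<open>B\<close>, and a finite field
  leaves finitely many such sums.\<close>

lemma finite_span_of_finite:
  assumes "finite B" "finite (UNIV :: 'a set)"
  shows "finite (span B)"
  using assms(1)
proof (induction B)
  case (insert a B)
  have "span (insert a B) \<subseteq> (\<lambda>(k, v). scale k a + v) ` (UNIV \<times> span B)"
  proof
    fix v assume "v \<in> span (insert a B)"
    then obtain k where "v - scale k a \<in> span B"
      using span_breakdown_eq by blast
    then show "v \<in> (\<lambda>(k, v). scale k a + v) ` (UNIV \<times> span B)"
      by (intro image_eqI[where x = "(k, v - scale k a)"]) auto
  qed
  then show ?case
    using insert assms(2) by (meson finite_SigmaI finite_imageI finite_subset)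
qed simp

text \<open>The image of a basis of \<open>S\<close> is independent and has as many elements as the
  basis. A vector of \<open>S\<close> outside the span of that image would enlarge it to an
  independent set exceeding the dimension of \<open>S\<close>.\<close>

lemma linear_inj_on_imp_surj_on_subspace:
  assumes lin: "Vector_Spaces.linear scale scale f"
    and "finite F" "S \<subseteq> span F" "subspace S"
    and "f ` S \<subseteq> S" "inj_on f S"
  shows "f ` S = S"
proof
  note hom = linear_iff_module_hom[THEN iffD1, OF lin]
  obtain B where B: "B \<subseteq> S" "independent B" "S \<subseteq> span B"
    by (rule basis_exists[of S])
  have finB: "finite B"
    using independent_span_bound[OF assms(2) B(2)] B(1) assms(3) by blast
  have spanB: "span B = S"
    using span_minimal[OF B(1) assms(4)] B(3) by blast
  have ind: "independent (f ` B)"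
    using module_hom.independent_injective_image[OF hom B(2)] assms(6) spanB by simp
  have card: "card (f ` B) = card B"
    using assms(6) B(1) by (meson card_image inj_on_subset)
  show "S \<subseteq> f ` S"
  proof
    fix v assume v: "v \<in> S"
    show "v \<in> f ` S"
    proof (rule ccontr)
      assume "v \<notin> f ` S"
      then have nv: "v \<notin> span (f ` B)"
        using module_hom.span_image[OF hom, of B] spanB by simp
      have "insert v (f ` B) \<subseteq> span B"
        using v B(1) assms(5) spanB by blast
      then have "card (insert v (f ` B)) \<le> card B"
        using independent_span_bound[OF finB independent_insertI[OF nv ind]] by blast
      moreover have "v \<notin> f ` B"
        using nv span_base by blast
      ultimately show False
        using card finB by simp
    qed
  qed
qed fact

end

section \<open>Matrix algebras\<close>

text \<open>The scalar multiplication of \<open>End_alg X\<close> as an operation on the whole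
  function type, independent of \<open>X\<close>, so that \<open>vector_space\<close> can be
  interpreted.\<close>

definition mscale :: "complex \<Rightarrow> 'x cmat \<Rightarrow> 'x cmat" where
  "mscale c M = (\<lambda>y z. c * M y z)"

interpretation cvec: vector_space "vscale :: complex \<Rightarrow> 'x cvec \<Rightarrow> 'x cvec"
  by standard (auto simp: vscale_def fun_eq_iff algebra_simps)

interpretation cmat: vector_space "mscale :: complex \<Rightarrow> 'x cmat \<Rightarrow> 'x cmat"
  by standard (auto simp: mscale_def fun_eq_iff algebra_simps)

lemma End_alg_simps [simp]:
  "M \<oplus>\<^bsub>End_alg X\<^esub> N = M + N"
  "c \<odot>\<^bsub>End_alg X\<^esub> M = mscale c M"
  "\<zero>\<^bsub>End_alg X\<^esub> = 0"
  by (auto simp: End_alg_def mscale_def fun_eq_iff)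

lemma End_alg_mult:
  "M \<otimes>\<^bsub>End_alg X\<^esub> N = (\<lambda>y z. \<Sum>w\<in>X. M y w * N w z)"
  by (simp add: End_alg_def)

lemma End_alg_one:
  "\<one>\<^bsub>End_alg X\<^esub> = (\<lambda>y z. if y = z \<and> y \<in> X then 1 else 0)"
  by (simp add: End_alg_def)

lemma End_alg_carrier:
  "M \<in> carrier (End_alg X) \<longleftrightarrow> (\<forall>y z. \<not> (y \<in> X \<and> z \<in> X) \<longrightarrow> M y z = 0)"
  by (simp add: End_alg_def)

lemma End_alg_mult_linear:
  "(M + M') \<otimes>\<^bsub>End_alg X\<^esub> N = M \<otimes>\<^bsub>End_alg X\<^esub> N + M' \<otimes>\<^bsub>End_alg X\<^esub> N"
  "(M - M') \<otimes>\<^bsub>End_alg X\<^esub> N = M \<otimes>\<^bsub>End_alg X\<^esub> N - M' \<otimes>\<^bsub>End_alg X\<^esub> N"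
  "N \<otimes>\<^bsub>End_alg X\<^esub> (M + M') = N \<otimes>\<^bsub>End_alg X\<^esub> M + N \<otimes>\<^bsub>End_alg X\<^esub> M'"
  "N \<otimes>\<^bsub>End_alg X\<^esub> (M - M') = N \<otimes>\<^bsub>End_alg X\<^esub> M - N \<otimes>\<^bsub>End_alg X\<^esub> M'"
  "mscale c M \<otimes>\<^bsub>End_alg X\<^esub> N = mscale c (M \<otimes>\<^bsub>End_alg X\<^esub> N)"
  "N \<otimes>\<^bsub>End_alg X\<^esub> mscale c M = mscale c (N \<otimes>\<^bsub>End_alg X\<^esub> M)"
  by (auto simp: End_alg_mult mscale_def fun_eq_iff algebra_simps sum.distrib sum_subtractf
      sum_distrib_left)

lemma End_alg_mult_assoc:
  "M \<otimes>\<^bsub>End_alg X\<^esub> N \<otimes>\<^bsub>End_alg X\<^esub> L = M \<otimes>\<^bsub>End_alg X\<^esub> (N \<otimes>\<^bsub>End_alg X\<^esub> L)"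
proof (intro ext)
  fix y z
  have "(\<Sum>w\<in>X. \<Sum>v\<in>X. M y v * N v w * L w z) = (\<Sum>v\<in>X. \<Sum>w\<in>X. M y v * N v w * L w z)"
    by (rule sum.swap)
  then show "(M \<otimes>\<^bsub>End_alg X\<^esub> N \<otimes>\<^bsub>End_alg X\<^esub> L) y z =
      (M \<otimes>\<^bsub>End_alg X\<^esub> (N \<otimes>\<^bsub>End_alg X\<^esub> L)) y z"
    by (simp add: End_alg_mult sum_distrib_left sum_distrib_right mult.assoc)
qed

lemma End_alg_mult_one:
  assumes "finite X" "M \<in> carrier (End_alg X)"
  shows "\<one>\<^bsub>End_alg X\<^esub> \<otimes>\<^bsub>End_alg X\<^esub> M = M" "M \<otimes>\<^bsub>End_alg X\<^esub> \<one>\<^bsub>End_alg X\<^esub> = M"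
proof -
  have "(\<Sum>w\<in>X. (if y = w \<and> y \<in> X then 1 else 0) * M w z) = M y z" for y z
  proof -
    have "(\<Sum>w\<in>X. (if y = w \<and> y \<in> X then 1 else 0) * M w z) =
        (\<Sum>w\<in>X. if y = w then M w z else 0)"
      by (rule sum.cong) auto
    then show ?thesis
      using assms by (auto simp: End_alg_carrier)
  qed
  then show "\<one>\<^bsub>End_alg X\<^esub> \<otimes>\<^bsub>End_alg X\<^esub> M = M"
    by (simp add: End_alg_mult End_alg_one fun_eq_iff)
  have "(\<Sum>w\<in>X. M y w * (if w = z \<and> w \<in> X then 1 else 0)) = M y z" for y z
  proof -
    have "(\<Sum>w\<in>X. M y w * (if w = z \<and> w \<in> X then 1 else 0)) =
        (\<Sum>w\<in>X. if w = z then M y w else 0)"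
      by (rule sum.cong) auto
    then show ?thesis
      using assms by (auto simp: End_alg_carrier)
  qed
  then show "M \<otimes>\<^bsub>End_alg X\<^esub> \<one>\<^bsub>End_alg X\<^esub> = M"
    by (simp add: End_alg_mult End_alg_one fun_eq_iff)
qed

lemma complex_subalgebra_carrier: "complex_subalgebra (End_alg X) (carrier (End_alg X))"
  by (auto simp: complex_subalgebra_def End_alg_carrier End_alg_mult End_alg_one mscale_def)

text \<open>Gives access to uniqueness of inverses, which later identifies \<open>inv\<close> with
  an explicit matrix.\<close>

lemma End_alg_monoid:
  assumes "finite X"
  shows "Group.monoid (End_alg X)"
  by (rule Group.monoidI)
    (use assms complex_subalgebra_carrier[of X] in
      \<open>auto simp: complex_subalgebra_def End_alg_mult_assoc End_alg_mult_one\<close>)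

lemma complex_subalgebra_closed:
  assumes "complex_subalgebra (End_alg X) K"
  shows "\<And>M N. M \<in> K \<Longrightarrow> N \<in> K \<Longrightarrow> M + N \<in> K"
    "\<And>M N. M \<in> K \<Longrightarrow> N \<in> K \<Longrightarrow> M \<otimes>\<^bsub>End_alg X\<^esub> N \<in> K"
    "\<And>c M. M \<in> K \<Longrightarrow> mscale c M \<in> K"
    "\<And>M N. M \<in> K \<Longrightarrow> N \<in> K \<Longrightarrow> M - N \<in> K"
    "\<one>\<^bsub>End_alg X\<^esub> \<in> K" "\<And>M. M \<in> K \<Longrightarrow> M \<in> carrier (End_alg X)" "0 \<in> K"
proof -
  show add: "M + N \<in> K" if "M \<in> K" "N \<in> K" for M N
    using assms that by (auto simp: complex_subalgebra_def)
  show scale: "mscale c M \<in> K" if "M \<in> K" for c M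
    using assms that by (auto simp: complex_subalgebra_def)
  show "M - N \<in> K" if "M \<in> K" "N \<in> K" for M N
    using add[OF that(1) scale[OF that(2), of "-1"]] by (simp add: cmat.scale_minus_left)
  show one: "\<one>\<^bsub>End_alg X\<^esub> \<in> K"
    using assms by (auto simp: complex_subalgebra_def)
  show "0 \<in> K"
    using scale[OF one, of 0] by simp
qed (use assms in \<open>auto simp: complex_subalgebra_def\<close>)

text \<open>The hull is an intersection of subalgebras. As the carrier is itself a subalgebra
  containing \<open>S\<close>, the intersection is nonempty and stays inside the carrier.\<close>

lemma complex_subalgebra_hull:
  assumes "S \<subseteq> carrier R" "complex_subalgebra R (carrier R)"
  shows "complex_subalgebra R (generated_algebra R S)"
proof -
  have mem: "a \<in> generated_algebra R S \<longleftrightarrow> (\<forall>K. complex_subalgebra R K \<and> S \<subseteq> K \<longrightarrow> a \<in> K)" for a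
    by (auto simp: generated_algebra_def hull_def)
  show ?thesis
    unfolding complex_subalgebra_def[of R "generated_algebra R S"]
  proof (intro conjI ballI allI subsetI)
    fix a assume "a \<in> generated_algebra R S"
    then show "a \<in> carrier R"
      using mem assms by blast
  qed (auto simp: mem complex_subalgebra_def)
qed

section \<open>Finite dimension and inverses inside subalgebras\<close>

lemma complex_subalgebra_subspace:
  "complex_subalgebra (End_alg X) K \<Longrightarrow> cmat.subspace K"
  by (auto simp: cmat.subspace_def complex_subalgebra_closed)

lemma vecs_finite_span:
  assumes "finite X"
  obtains F where "finite F" "vecs X \<subseteq> cvec.span F"
proof
  \<comment> \<open>The unit vectors.\<close>
  let ?u = "\<lambda>a y. if y = a then 1 else 0 :: complex"
  show "finite (?u ` X)"
    using assms by simp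
  show "vecs X \<subseteq> cvec.span (?u ` X)"
  proof
    fix v assume v: "v \<in> vecs X"
    have "v = (\<Sum>a\<in>X. vscale (v a) (?u a))"
    proof
      fix y
      have "(\<Sum>a\<in>X. vscale (v a) (?u a)) y = (\<Sum>a\<in>X. if y = a then v a else 0)"
        using assms by (induction X) (auto simp: vscale_def)
      then show "v y = (\<Sum>a\<in>X. vscale (v a) (?u a)) y"
        using v assms by (auto simp: vecs_def)
    qed
    also have "\<dots> \<in> cvec.span (?u ` X)"
      by (intro cvec.span_sum cvec.span_scale cvec.span_base imageI)
    finally show "v \<in> cvec.span (?u ` X)" .
  qed
qed

lemma End_alg_finite_span:
  assumes "finite X"
  obtains F where "finite F" "carrier (End_alg X) \<subseteq> cmat.span F"
proof
  \<comment> \<open>The matrix units.\<close>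
  let ?u = "\<lambda>(a, b) y z. if y = a \<and> z = b then 1 else 0 :: complex"
  show "finite (?u ` (X \<times> X))"
    using assms by simp
  show "carrier (End_alg X) \<subseteq> cmat.span (?u ` (X \<times> X))"
  proof
    fix M assume M: "M \<in> carrier (End_alg X)"
    have "M = (\<Sum>p\<in>X \<times> X. mscale (M (fst p) (snd p)) (?u p))"
    proof (intro ext)
      fix y z
      \<comment> \<open>Induction runs over an arbitrary finite set of pairs, since
        \<open>X \<times> X\<close> does not grow one pair at a time.\<close>
      have "(\<Sum>p\<in>P. mscale (M (fst p) (snd p)) (?u p)) y z =
          (\<Sum>p\<in>P. if (y, z) = p then M y z else 0)" if "finite P" for P
        using that by (induction P) (auto simp: mscale_def split: if_splits)
      then show "M y z = (\<Sum>p\<in>X \<times> X. mscale (M (fst p) (snd p)) (?u p)) y z"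
        using M assms by (auto simp: End_alg_carrier)
    qed
    also have "\<dots> \<in> cmat.span (?u ` (X \<times> X))"
      by (intro cmat.span_sum cmat.span_scale cmat.span_base imageI)
    finally show "M \<in> cmat.span (?u ` (X \<times> X))" .
  qed
qed

text \<open>Left multiplication by \<open>C\<close> is an injective linear map of the
  finite-dimensional space \<open>K\<close> into itself, hence surjective, so it takes the value
  one.\<close>

lemma subalgebra_right_inverse:
  assumes "finite X" and K: "complex_subalgebra (End_alg X) K" and "C \<in> K"
    and inj: "\<And>M. M \<in> K \<Longrightarrow> C \<otimes>\<^bsub>End_alg X\<^esub> M = 0 \<Longrightarrow> M = 0"
  obtains N where "N \<in> K" "C \<otimes>\<^bsub>End_alg X\<^esub> N = \<one>\<^bsub>End_alg X\<^esub>"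
proof -
  note closed = complex_subalgebra_closed[OF K]
  obtain F where F: "finite F" "carrier (End_alg X) \<subseteq> cmat.span F"
    using End_alg_finite_span[OF assms(1)] .
  have KF: "K \<subseteq> cmat.span F"
    using closed(6) F(2) by blast
  have lin: "Vector_Spaces.linear mscale mscale (\<lambda>M. C \<otimes>\<^bsub>End_alg X\<^esub> M)"
    by standard (simp_all add: End_alg_mult_linear)
  have maps: "(\<lambda>M. C \<otimes>\<^bsub>End_alg X\<^esub> M) ` K \<subseteq> K"
    using closed(2) assms(3) by blast
  have "inj_on (\<lambda>M. C \<otimes>\<^bsub>End_alg X\<^esub> M) K"
  proof (rule inj_onI)
    fix M N assume *: "M \<in> K" "N \<in> K" "C \<otimes>\<^bsub>End_alg X\<^esub> M = C \<otimes>\<^bsub>End_alg X\<^esub> N"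
    then have "C \<otimes>\<^bsub>End_alg X\<^esub> (M - N) = 0"
      by (simp add: End_alg_mult_linear)
    then show "M = N"
      using inj[of "M - N"] closed(4) * by simp
  qed
  then have "(\<lambda>M. C \<otimes>\<^bsub>End_alg X\<^esub> M) ` K = K"
    using cmat.linear_inj_on_imp_surj_on_subspace[OF lin F(1) KF complex_subalgebra_subspace[OF K] maps]
    by blast
  then show ?thesis
    using closed(5) that by (metis (no_types, lifting) imageE)
qed

text \<open>A left inverse \<open>N\<close> of \<open>C\<close> makes left multiplication by
  \<open>C\<close> injective on \<open>K\<close>. So \<open>K\<close> contains a right inverse of
  \<open>C\<close>, which must be equal to \<open>N\<close>.\<close>

lemma subalgebra_contains_inverse:
  assumes "finite X" and K: "complex_subalgebra (End_alg X) K" and "C \<in> K"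
    and N: "N \<in> carrier (End_alg X)" "N \<otimes>\<^bsub>End_alg X\<^esub> C = \<one>\<^bsub>End_alg X\<^esub>"
  shows "N \<in> K"
proof -
  note closed = complex_subalgebra_closed[OF K]
  have cancel: "N \<otimes>\<^bsub>End_alg X\<^esub> (C \<otimes>\<^bsub>End_alg X\<^esub> M) = M" if "M \<in> K" for M
    using End_alg_mult_one(1)[OF assms(1) closed(6)[OF that]] N(2)
    by (simp flip: End_alg_mult_assoc)
  have N0: "N \<otimes>\<^bsub>End_alg X\<^esub> 0 = 0"
    by (auto simp: End_alg_mult fun_eq_iff)
  obtain L where L: "L \<in> K" "C \<otimes>\<^bsub>End_alg X\<^esub> L = \<one>\<^bsub>End_alg X\<^esub>"
    by (rule subalgebra_right_inverse[OF assms(1) K assms(3)]) (use cancel N0 in metis)+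
  then have "N = L"
    using cancel[OF L(1)] End_alg_mult_one(2)[OF assms(1) N(1)] by simp
  with L show ?thesis by simp
qed

section \<open>Central elements\<close>

lemma apply_mat_mult:
  "apply_mat X (M \<otimes>\<^bsub>End_alg X\<^esub> N) v = apply_mat X M (apply_mat X N v)"
proof
  fix y
  have "(\<Sum>z\<in>X. \<Sum>w\<in>X. M y w * N w z * v z) = (\<Sum>w\<in>X. \<Sum>z\<in>X. M y w * N w z * v z)"
    by (rule sum.swap)
  then show "apply_mat X (M \<otimes>\<^bsub>End_alg X\<^esub> N) v y = apply_mat X M (apply_mat X N v) y"
    by (simp add: apply_mat_def End_alg_mult sum_distrib_left sum_distrib_right mult.assoc)
qed

lemma apply_mat_linear:
  "apply_mat X M 0 = 0"
  "apply_mat X M (v + w) = apply_mat X M v + apply_mat X M w"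
  "apply_mat X M (vscale c v) = vscale c (apply_mat X M v)"
  by (auto simp: apply_mat_def vscale_def fun_eq_iff algebra_simps sum.distrib sum_distrib_left)

lemma apply_mat_in_vecs:
  "M \<in> carrier (End_alg X) \<Longrightarrow> apply_mat X M v \<in> vecs X"
  by (auto simp: vecs_def apply_mat_def End_alg_carrier)

text \<open>A nonzero submodule of least dimension inside \<open>U\<close> is irreducible, because a
  proper submodule has smaller dimension.\<close>

lemma irreducible_submodule_exists:
  assumes "finite X" "submodule_of X T U" "U \<noteq> {0}"
  obtains W where "irreducible_module X T W" "W \<subseteq> U"
proof -
  obtain F where F: "finite F" "vecs X \<subseteq> cvec.span F"
    using vecs_finite_span[OF assms(1)] .
  obtain W where W: "submodule_of X T W \<and> W \<noteq> {0} \<and> W \<subseteq> U"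
    and min: "\<And>W'. submodule_of X T W' \<and> W' \<noteq> {0} \<and> W' \<subseteq> U \<Longrightarrow> cvec.dim W \<le> cvec.dim W'"
    using ex_has_least_nat[of "\<lambda>W. submodule_of X T W \<and> W \<noteq> {0} \<and> W \<subseteq> U" U "cvec.dim"] assms
    by blast
  have "irreducible_module X T W"
    unfolding irreducible_module_def
  proof (intro conjI allI impI)
    fix W' assume W': "submodule_of X T W' \<and> W' \<subseteq> W"
    show "W' = {0} \<or> W' = W"
    proof (rule ccontr)
      assume *: "\<not> ?thesis"
      have "cvec.dim W' < cvec.dim W"
        using cvec.dim_strict_mono_subspace[OF F(1), of W W'] W W' F(2) *
        by (auto simp: submodule_of_def)
      with min[of W'] W W' * show False by force
    qed
  qed (use W in auto)
  then show ?thesis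
    using that W by blast
qed

text \<open>
  The kernel of a central element is a submodule. Were it nonzero, it would contain an irreducible
  submodule, on which the element acts as a power of \<open>q\<close>.
\<close>

lemma central_q_power_kernel:
  assumes "finite X" "T \<subseteq> carrier (End_alg X)" "q \<noteq> 0" "central_q_power X T q f C"
    and "v \<in> vecs X" "apply_mat X C v = 0"
  shows "v = 0"
proof (rule ccontr)
  assume "v \<noteq> 0"
  define U where "U = {w \<in> vecs X. apply_mat X C w = 0}"
  have "submodule_of X T U"
    unfolding submodule_of_def
  proof (intro conjI ballI)
    show "cvec.subspace U"
      by (auto simp: cvec.subspace_def U_def apply_mat_linear)
        (auto simp: vecs_def vscale_def)
    fix B w assume B: "B \<in> T" "w \<in> U"
    have "apply_mat X C (apply_mat X B w) = apply_mat X B (apply_mat X C w)"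
      using assms(4) B(1) by (simp add: central_q_power_def flip: apply_mat_mult)
    then show "apply_mat X B w \<in> U"
      using B assms(2) by (auto simp: U_def apply_mat_linear intro: apply_mat_in_vecs)
  qed (auto simp: U_def)
  moreover have "U \<noteq> {0}"
    using \<open>v \<noteq> 0\<close> assms(5,6) by (auto simp: U_def)
  ultimately obtain W where W: "irreducible_module X T W" "W \<subseteq> U"
    using irreducible_submodule_exists[OF assms(1)] by blast
  have "w = 0" if "w \<in> W" for w
  proof -
    have "w \<in> cvec.span (\<Union>{W'. irreducible_module X T W' \<and> f W' = f W})"
      by (rule cvec.span_base) (use W that in blast)
    then have "apply_mat X C w = vscale (q powi f W) w"
      using assms(4) by (auto simp: central_q_power_def)
    moreover have "apply_mat X C w = 0"
      using W(2) that by (auto simp: U_def)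
    ultimately show "w = 0"
      using assms(3) by (auto simp: power_int_eq_0_iff)
  qed
  moreover have "W \<noteq> {0}" "0 \<in> W"
    using W(1) by (auto simp: irreducible_module_def submodule_of_def cvec.subspace_def)
  ultimately show False by blast
qed

text \<open>If \<open>C\<close> times \<open>M\<close> is zero, the columns of \<open>M\<close> lie
  in the kernel of \<open>C\<close> and vanish. So left multiplication by \<open>C\<close> is
  injective on \<open>T\<close>, which yields a right inverse in \<open>T\<close>; centrality makes
  it two-sided.\<close>

lemma central_q_power_inverse:
  assumes "finite X" and T: "complex_subalgebra (End_alg X) T"
    and "q \<noteq> 0" and C: "central_q_power X T q f C"
  shows "inv\<^bsub>End_alg X\<^esub> C \<in> T"
    "inv\<^bsub>End_alg X\<^esub> C \<otimes>\<^bsub>End_alg X\<^esub> C = \<one>\<^bsub>End_alg X\<^esub>"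
    "C \<otimes>\<^bsub>End_alg X\<^esub> inv\<^bsub>End_alg X\<^esub> C = \<one>\<^bsub>End_alg X\<^esub>"
    "\<And>B. B \<in> T \<Longrightarrow>
       inv\<^bsub>End_alg X\<^esub> C \<otimes>\<^bsub>End_alg X\<^esub> B = B \<otimes>\<^bsub>End_alg X\<^esub> inv\<^bsub>End_alg X\<^esub> C"
proof -
  interpret R: Group.monoid "End_alg X"
    using assms(1) by (rule End_alg_monoid)
  note closed = complex_subalgebra_closed[OF T]
  have CT: "C \<in> T"
    using C by (simp add: central_q_power_def)
  have "M = 0" if M: "M \<in> T" "C \<otimes>\<^bsub>End_alg X\<^esub> M = 0" for M
  proof (intro ext)
    fix y z
    have "(\<lambda>w. M w z) = 0"
    proof (rule central_q_power_kernel[OF assms(1) _ assms(3) C])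
      show "T \<subseteq> carrier (End_alg X)"
        using closed(6) by blast
      show "(\<lambda>w. M w z) \<in> vecs X"
        using closed(6)[OF M(1)] by (auto simp: vecs_def End_alg_carrier)
      show "apply_mat X C (\<lambda>w. M w z) = 0"
        using M(2) by (auto simp: apply_mat_def End_alg_mult fun_eq_iff)
    qed
    then show "M y z = 0 y z"
      by (simp add: fun_eq_iff)
  qed
  then obtain N where N: "N \<in> T" "C \<otimes>\<^bsub>End_alg X\<^esub> N = \<one>\<^bsub>End_alg X\<^esub>"
    using subalgebra_right_inverse[OF assms(1) T CT] by blast
  moreover have NC: "N \<otimes>\<^bsub>End_alg X\<^esub> C = \<one>\<^bsub>End_alg X\<^esub>"
    using C N by (simp add: central_q_power_def)
  ultimately have inv: "inv\<^bsub>End_alg X\<^esub> C = N"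
    using R.inv_unique'[of C N] closed(6) CT by simp
  show "inv\<^bsub>End_alg X\<^esub> C \<otimes>\<^bsub>End_alg X\<^esub> B = B \<otimes>\<^bsub>End_alg X\<^esub> inv\<^bsub>End_alg X\<^esub> C" if B: "B \<in> T" for B
  proof -
    note one = End_alg_mult_one[OF assms(1) closed(6)]
    \<comment> \<open>The inverse inherits centrality: insert \<open>C N = 1\<close> behind
      \<open>N B\<close>, then move \<open>C\<close> past \<open>B\<close> and cancel it against the
      left \<open>N\<close>.\<close>
    have "N \<otimes>\<^bsub>End_alg X\<^esub> B = N \<otimes>\<^bsub>End_alg X\<^esub> (B \<otimes>\<^bsub>End_alg X\<^esub> C) \<otimes>\<^bsub>End_alg X\<^esub> N"
      using N B by (simp add: End_alg_mult_assoc one)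
    also have "B \<otimes>\<^bsub>End_alg X\<^esub> C = C \<otimes>\<^bsub>End_alg X\<^esub> B"
      using C B by (simp add: central_q_power_def)
    also have "N \<otimes>\<^bsub>End_alg X\<^esub> (C \<otimes>\<^bsub>End_alg X\<^esub> B) \<otimes>\<^bsub>End_alg X\<^esub> N = B \<otimes>\<^bsub>End_alg X\<^esub> N"
      using NC B by (simp add: one flip: End_alg_mult_assoc)
    finally show ?thesis
      by (simp add: inv)
  qed
  from inv show "inv\<^bsub>End_alg X\<^esub> C \<in> T"
    "inv\<^bsub>End_alg X\<^esub> C \<otimes>\<^bsub>End_alg X\<^esub> C = \<one>\<^bsub>End_alg X\<^esub>"
    "C \<otimes>\<^bsub>End_alg X\<^esub> inv\<^bsub>End_alg X\<^esub> C = \<one>\<^bsub>End_alg X\<^esub>"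
    using N NC by simp_all
qed

section \<open>Homomorphisms from the quantum algebra\<close>

text \<open>
  Conjugation by \<open>z\<close> multiplies \<open>x - z\<inverse>\<close> by \<open>q\<^sup>-\<^sup>2\<close> and \<open>y - z\<inverse>\<close> by \<open>q\<^sup>2\<close>. As \<open>q\<^sup>4 \<noteq> 1\<close>, it separates
  the two summands of \<open>c\<^sub>1 x + c\<^sub>2 y\<close>. The elements \<open>c\<^sub>1\<close>, \<open>c\<^sub>2\<close> are only assumed to commute with
  \<open>z\<close>, because \<open>x\<close> and \<open>y\<close> are not yet known to lie in \<open>K\<close>.
\<close>

lemma equitable_generators_in_subalgebra:
  fixes X :: "'x set"
  defines "R \<equiv> End_alg X"
  assumes fin: "finite X" and K: "complex_subalgebra R K"
    and z: "z \<in> K" "zi \<in> carrier R" "z \<otimes>\<^bsub>R\<^esub> zi = \<one>\<^bsub>R\<^esub>" "zi \<otimes>\<^bsub>R\<^esub> z = \<one>\<^bsub>R\<^esub>"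
    and x: "x \<in> carrier R" and y: "y \<in> carrier R"
    and zx: "mscale q (z \<otimes>\<^bsub>R\<^esub> x) - mscale (inverse q) (x \<otimes>\<^bsub>R\<^esub> z) = mscale (q - inverse q) \<one>\<^bsub>R\<^esub>"
    and yz: "mscale q (y \<otimes>\<^bsub>R\<^esub> z) - mscale (inverse q) (z \<otimes>\<^bsub>R\<^esub> y) = mscale (q - inverse q) \<one>\<^bsub>R\<^esub>"
    and q: "q \<noteq> 0" "q ^ 4 \<noteq> 1"
    and c1: "c1 \<in> K" "d1 \<in> K" "d1 \<otimes>\<^bsub>R\<^esub> c1 = \<one>\<^bsub>R\<^esub>" "c1 \<otimes>\<^bsub>R\<^esub> z = z \<otimes>\<^bsub>R\<^esub> c1"
    and c2: "c2 \<in> K" "d2 \<in> K" "d2 \<otimes>\<^bsub>R\<^esub> c2 = \<one>\<^bsub>R\<^esub>" "c2 \<otimes>\<^bsub>R\<^esub> z = z \<otimes>\<^bsub>R\<^esub> c2"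
    and sum: "c1 \<otimes>\<^bsub>R\<^esub> x + c2 \<otimes>\<^bsub>R\<^esub> y \<in> K"
  shows "x \<in> K" "y \<in> K"
proof -
  note closed = complex_subalgebra_closed[OF K[unfolded R_def], folded R_def]
  note assoc = End_alg_mult_assoc[where X = X, folded R_def]
  note lin = End_alg_mult_linear[where X = X, folded R_def]
  note one = End_alg_mult_one[OF fin, folded R_def]
  have zi: "zi \<in> K"
    using subalgebra_contains_inverse[OF fin K[unfolded R_def] z(1)] z(2,4) by (simp add: R_def)
  \<comment> \<open>\<open>x'\<close> and \<open>y'\<close> are the conjugates of \<open>x\<close>
    and \<open>y\<close> by \<open>z\<close>; below, \<open>t\<close> is the conjugate of the known
    element \<open>s\<close>.\<close>
  define x' where "x' = z \<otimes>\<^bsub>R\<^esub> (x \<otimes>\<^bsub>R\<^esub> zi)"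
  define y' where "y' = z \<otimes>\<^bsub>R\<^esub> (y \<otimes>\<^bsub>R\<^esub> zi)"
  define p where "p = c1 \<otimes>\<^bsub>R\<^esub> x"
  define r where "r = c2 \<otimes>\<^bsub>R\<^esub> y"
  define s where "s = p + r"
  define t where "t = z \<otimes>\<^bsub>R\<^esub> (s \<otimes>\<^bsub>R\<^esub> zi)"
  define u1 where "u1 = c1 \<otimes>\<^bsub>R\<^esub> zi"
  define u2 where "u2 = c2 \<otimes>\<^bsub>R\<^esub> zi"
  have sK: "s \<in> K"
    using sum by (simp add: s_def p_def r_def)
  have tK: "t \<in> K" "u1 \<in> K" "u2 \<in> K"
    unfolding t_def u1_def u2_def using z(1) zi sK c1(1) c2(1) by (auto intro!: closed(2))
  \<comment> \<open>The relation between \<open>z\<close> and \<open>x\<close>, multiplied by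
    \<open>zi\<close> on the right; it says that \<open>x' - zi\<close> is \<open>q\<close> to the
    power -2 times \<open>x - zi\<close>. The relation for \<open>y\<close> is treated
    alike.\<close>
  have "mscale q x' - mscale (inverse q) x = mscale (q - inverse q) zi"
    using arg_cong[OF zx, of "\<lambda>M. M \<otimes>\<^bsub>R\<^esub> zi"]
    by (simp add: lin assoc z(3) one x z(2) x'_def)
  from arg_cong[OF this, of "\<lambda>M. c1 \<otimes>\<^bsub>R\<^esub> M"]
  have E1: "mscale q (c1 \<otimes>\<^bsub>R\<^esub> x') - mscale (inverse q) p = mscale (q - inverse q) u1"
    by (simp add: lin p_def u1_def)
  have "mscale q y - mscale (inverse q) y' = mscale (q - inverse q) zi"
    using arg_cong[OF yz, of "\<lambda>M. M \<otimes>\<^bsub>R\<^esub> zi"]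
    by (simp add: lin assoc z(3) one y z(2) y'_def)
  from arg_cong[OF this, of "\<lambda>M. c2 \<otimes>\<^bsub>R\<^esub> M"]
  have E2: "mscale q r - mscale (inverse q) (c2 \<otimes>\<^bsub>R\<^esub> y') = mscale (q - inverse q) u2"
    by (simp add: lin r_def u2_def)
  \<comment> \<open>As \<open>z\<close> commutes with \<open>c1\<close> and \<open>c2\<close>,
    conjugation of \<open>s\<close> reaches only \<open>x\<close> and \<open>y\<close>.\<close>
  have "z \<otimes>\<^bsub>R\<^esub> (c1 \<otimes>\<^bsub>R\<^esub> M) = c1 \<otimes>\<^bsub>R\<^esub> (z \<otimes>\<^bsub>R\<^esub> M)"
    "z \<otimes>\<^bsub>R\<^esub> (c2 \<otimes>\<^bsub>R\<^esub> M) = c2 \<otimes>\<^bsub>R\<^esub> (z \<otimes>\<^bsub>R\<^esub> M)" for M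
    using c1(4) c2(4) by (simp_all flip: assoc)
  then have t: "t = c1 \<otimes>\<^bsub>R\<^esub> x' + c2 \<otimes>\<^bsub>R\<^esub> y'"
    by (simp add: t_def s_def p_def r_def x'_def y'_def lin assoc)
  \<comment> \<open>The difference of the two eigenvalues of conjugation by
    \<open>z\<close>.\<close>
  define w where "w = 1 / q\<^sup>2 - q\<^sup>2"
  have w: "w \<noteq> 0"
  proof
    assume "w = 0"
    then have "q\<^sup>2 * q\<^sup>2 = 1"
      using q(1) by (simp add: w_def field_simps)
    then show False
      using q(2) by (simp flip: power_add)
  qed
  \<comment> \<open>In \<open>t - q\<^sup>2 s\<close> the contributions of \<open>r\<close> cancel;
    what remains is \<open>w p\<close> up to multiples of \<open>u1\<close> and \<open>u2\<close>,
    which lie in \<open>K\<close>.\<close>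
  have "mscale w p =
      t - mscale (q\<^sup>2) s - mscale ((q - inverse q) / q) u1 + mscale (q * (q - inverse q)) u2"
  proof (intro ext)
    fix i j
    define a b where "a = (c1 \<otimes>\<^bsub>R\<^esub> x') i j" and "b = (c2 \<otimes>\<^bsub>R\<^esub> y') i j"
    have "q * a - inverse q * p i j = (q - inverse q) * u1 i j"
      "q * r i j - inverse q * b = (q - inverse q) * u2 i j"
      using fun_cong[OF fun_cong[OF E1, of i], of j] fun_cong[OF fun_cong[OF E2, of i], of j]
      by (simp_all add: mscale_def a_def b_def)
    then have "a = ((q - inverse q) * u1 i j + inverse q * p i j) / q"
      "b = q * (q * r i j - (q - inverse q) * u2 i j)"
      using q(1) by (simp_all add: field_simps)
    then show "mscale w p i j =
        (t - mscale (q\<^sup>2) s - mscale ((q - inverse q) / q) u1 + mscale (q * (q - inverse q)) u2) i j"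
      using q(1)
      by (simp add: t s_def mscale_def w_def flip: a_def b_def)
        (simp add: field_simps power2_eq_square)
  qed
  moreover have "t - mscale (q\<^sup>2) s - mscale ((q - inverse q) / q) u1
      + mscale (q * (q - inverse q)) u2 \<in> K"
    by (intro closed(1,3,4) sK tK)
  ultimately have "mscale (1 / w) (mscale w p) \<in> K"
    using closed(3) by simp
  then have pK: "p \<in> K"
    using w by simp
  moreover have "r \<in> K"
    using closed(4)[OF sK pK] by (simp add: s_def)
  moreover have "x = d1 \<otimes>\<^bsub>R\<^esub> p" "y = d2 \<otimes>\<^bsub>R\<^esub> r"
    by (simp_all add: p_def r_def c1(3) c2(3) one x y flip: assoc)
  ultimately show "x \<in> K" "y \<in> K"
    using closed(2) c1(2) c2(2) by simp_all
qed

section \<open>The quantum algebra as a quotient of the free algebra\<close>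

lemma ring_free_alg: "ring free_alg"
proof (rule ringI)
  show "abelian_group free_alg"
    by (rule abelian_groupI)
      (auto simp: free_alg_def algebra_simps intro: exI[of _ "- x" for x])
  show "Group.monoid free_alg"
    by (rule Group.monoidI) (auto simp: free_alg_def algebra_simps)
qed (auto simp: free_alg_def algebra_simps)

lemma free_alg_simps:
  "carrier free_alg = UNIV" "a \<otimes>\<^bsub>free_alg\<^esub> b = a * b" "\<one>\<^bsub>free_alg\<^esub> = 1"
  "\<zero>\<^bsub>free_alg\<^esub> = 0" "a \<oplus>\<^bsub>free_alg\<^esub> b = a + b" "c \<odot>\<^bsub>free_alg\<^esub> a = scalar c * a"
  by (simp_all add: free_alg_def)

lemma ideal_uq_ideal: "ideal (uq_ideal q) free_alg"
  unfolding uq_ideal_def by (rule ring.genideal_ideal[OF ring_free_alg]) (simp add: free_alg_simps)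

lemma uq_relations:
  "{gen GZ * gen GZinv - 1, gen GZinv * gen GZ - 1,
    q_weyl q (gen GX) (gen GY), q_weyl q (gen GY) (gen GZ), q_weyl q (gen GZ) (gen GX)} \<subseteq> uq_ideal q"
  unfolding uq_ideal_def by (rule ring.genideal_self[OF ring_free_alg]) (simp add: free_alg_simps)

lemma uq_simps:
  "carrier (uq q) = carrier (free_alg Quot uq_ideal q)"
  "a \<otimes>\<^bsub>uq q\<^esub> b = a \<otimes>\<^bsub>free_alg Quot uq_ideal q\<^esub> b"
  "\<one>\<^bsub>uq q\<^esub> = \<one>\<^bsub>free_alg Quot uq_ideal q\<^esub>"
  "a \<oplus>\<^bsub>uq q\<^esub> b = a \<oplus>\<^bsub>free_alg Quot uq_ideal q\<^esub> b"
  "c \<odot>\<^bsub>uq q\<^esub> C = (\<Union>a\<in>C. uq_coset q (c \<odot>\<^bsub>free_alg\<^esub> a))"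
  by (simp_all add: uq_def ring.defs module.defs)

lemma carrier_uq: "carrier (uq q) = range (uq_coset q)"
  by (auto simp: uq_simps FactRing_def A_RCOSETS_def' free_alg_simps uq_coset_def)

lemma uq_coset_eq_iff: "uq_coset q a = uq_coset q b \<longleftrightarrow> a - b \<in> uq_ideal q"
proof -
  interpret I: ideal "uq_ideal q" free_alg by (rule ideal_uq_ideal)
  have "\<ominus>\<^bsub>free_alg\<^esub> b = - b"
    by (rule I.minus_equality) (simp_all add: free_alg_simps)
  then have "a \<ominus>\<^bsub>free_alg\<^esub> b = a - b"
    by (simp add: a_minus_def free_alg_simps)
  then show ?thesis
    using I.quotient_eq_iff_same_a_r_cos[OF ideal_uq_ideal, of a b q]
    by (simp add: free_alg_simps uq_coset_def)
qed

lemma mem_uq_coset: "b \<in> uq_coset q a \<longleftrightarrow> b - a \<in> uq_ideal q"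
  by (auto simp: uq_coset_def a_r_coset_def' free_alg_simps intro: bexI[of _ "b - a"])

text \<open>Compatibility with scalars needs an argument: the scalar action on a coset is a union
  over its representatives. The ideal absorbs left multiplication by \<open>scalar c\<close>, so all
  representatives give the same coset.\<close>

lemma uq_coset_hom: "uq_coset q \<in> complex_alg_hom free_alg (uq q)"
proof -
  interpret I: ideal "uq_ideal q" free_alg by (rule ideal_uq_ideal)
  have "uq_coset q \<in> ring_hom free_alg (uq q)"
    using I.rcos_ring_hom by (simp add: ring_hom_def uq_simps uq_coset_def[abs_def])
  moreover have "uq_coset q (c \<odot>\<^bsub>free_alg\<^esub> a) = c \<odot>\<^bsub>uq q\<^esub> uq_coset q a" for c a
  proof -
    have "uq_coset q (scalar c * b) = uq_coset q (scalar c * a)" if "b \<in> uq_coset q a" for b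
      using I.I_l_closed[of "b - a" "scalar c"] that
      by (simp add: uq_coset_eq_iff mem_uq_coset free_alg_simps right_diff_distrib)
    moreover have "a \<in> uq_coset q a"
      using I.a_rcos_self by (simp add: uq_coset_def free_alg_simps)
    ultimately have "(\<Union>b\<in>uq_coset q a. uq_coset q (scalar c * b)) = uq_coset q (scalar c * a)"
      by (intro SUP_eq_const) blast+
    then show ?thesis
      by (simp add: uq_simps free_alg_simps)
  qed
  ultimately show ?thesis
    by (simp add: complex_alg_hom_def)
qed

section \<open>Images of the quantum algebra in matrix algebras\<close>

lemma complex_alg_hom_comp:
  assumes "f \<in> complex_alg_hom R S" "g \<in> complex_alg_hom S P"
  shows "(\<lambda>a. g (f a)) \<in> complex_alg_hom R P"
  using assms by (auto simp: complex_alg_hom_def ring_hom_def Pi_iff)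

text \<open>First words are treated by induction on their length, then monomials, then sums of
  monomials.\<close>

lemma free_alg_hom_in_subalgebra:
  assumes f: "f \<in> complex_alg_hom free_alg (End_alg X)"
    and K: "complex_subalgebra (End_alg X) K" and gens: "\<And>g. f (gen g) \<in> K"
  shows "f a \<in> K"
proof -
  note closed = complex_subalgebra_closed[OF K]
  have f_simps: "f (a + b) = f a + f b" "f (a * b) = f a \<otimes>\<^bsub>End_alg X\<^esub> f b"
    "f 1 = \<one>\<^bsub>End_alg X\<^esub>" "f (scalar c * a) = mscale c (f a)" for a b c
    using f by (auto simp: complex_alg_hom_def ring_hom_def free_alg_simps)
  have f0: "f 0 \<in> K"
    using f_simps(1)[of 0 0] closed(7) by simp
  have word: "f (Poly_Mapping.single l 1) \<in> K" for l
  proof (induction l)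
    case Nil
    have "Poly_Mapping.single [] 1 = (1 :: uq_free)"
      by (simp flip: zero_list_def)
    then show ?case
      using f_simps(3) closed(5) by simp
  next
    case (Cons g l)
    have "Poly_Mapping.single (g # l) 1 = gen g * Poly_Mapping.single l 1"
      by (simp add: gen_def mult_single plus_list_def)
    then show ?case
      using f_simps(2) closed(2) gens Cons by simp
  qed
  have mono: "f (Poly_Mapping.single l c) \<in> K" for l c
  proof -
    have "Poly_Mapping.single l c = scalar c * Poly_Mapping.single l 1"
      by (simp add: scalar_def mult_single plus_list_def)
    then show ?thesis
      using f_simps(4) closed(3) word by simp
  qed
  show ?thesis
  proof (induction a rule: update_induct)
    case const
    then show ?case using f0 by simp
  next
    case (update a l c)
    \<comment> \<open>The word \<open>l\<close> is not in the support of \<open>a\<close>, so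
      setting its coefficient amounts to adding a monomial.\<close>
    have "Poly_Mapping.update l c a = a + Poly_Mapping.single l c"
      using update(1)
      by (intro poly_mapping_eqI) (auto simp: lookup_update lookup_add lookup_single in_keys_iff)
    then show ?case
      using closed(1)[OF update(3) mono] by (simp only: f_simps)
  qed
qed

text \<open>Composed with the quotient map, \<open>\<pi>\<close> becomes a homomorphism from the
  free algebra that kills \<open>uq_ideal q\<close>; each relation then turns into an identity of
  matrices.\<close>

lemma uq_hom_relations:
  fixes X :: "'x set"
  defines "R \<equiv> End_alg X"
  assumes \<pi>: "\<pi> \<in> complex_alg_hom (uq q) R" and q: "q - inverse q \<noteq> 0"
  defines "f \<equiv> \<lambda>a. \<pi> (uq_coset q a)"
  shows "f (gen GZ) \<otimes>\<^bsub>R\<^esub> f (gen GZinv) = \<one>\<^bsub>R\<^esub>" "f (gen GZinv) \<otimes>\<^bsub>R\<^esub> f (gen GZ) = \<one>\<^bsub>R\<^esub>"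
    "mscale q (f (gen GZ) \<otimes>\<^bsub>R\<^esub> f (gen GX)) - mscale (inverse q) (f (gen GX) \<otimes>\<^bsub>R\<^esub> f (gen GZ)) =
     mscale (q - inverse q) \<one>\<^bsub>R\<^esub>"
    "mscale q (f (gen GY) \<otimes>\<^bsub>R\<^esub> f (gen GZ)) - mscale (inverse q) (f (gen GZ) \<otimes>\<^bsub>R\<^esub> f (gen GY)) =
     mscale (q - inverse q) \<one>\<^bsub>R\<^esub>"
proof -
  have "f \<in> complex_alg_hom free_alg R"
    unfolding f_def using uq_coset_hom \<pi> by (rule complex_alg_hom_comp)
  then have f_simps: "f (a + b) = f a + f b" "f (a * b) = f a \<otimes>\<^bsub>R\<^esub> f b"
    "f 1 = \<one>\<^bsub>R\<^esub>" "f (scalar c * a) = mscale c (f a)" for a b c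
    by (auto simp: complex_alg_hom_def ring_hom_def free_alg_simps R_def)
  have f_diff: "f (a - b) = f a - f b" for a b
    using f_simps(1)[of "a - b" b] by simp
  have ker: "f a = 0" if "a \<in> uq_ideal q" for a
  proof -
    have "f a = f 0"
      using that uq_coset_eq_iff[of q a 0] by (simp add: f_def)
    then show ?thesis
      using f_simps(1)[of 0 0] by simp
  qed
  have weyl: "mscale q (f a \<otimes>\<^bsub>R\<^esub> f b) - mscale (inverse q) (f b \<otimes>\<^bsub>R\<^esub> f a) =
      mscale (q - inverse q) \<one>\<^bsub>R\<^esub>" if "q_weyl q a b \<in> uq_ideal q" for a b
  proof -
    have "mscale (1 / (q - inverse q))
        (mscale q (f a \<otimes>\<^bsub>R\<^esub> f b) - mscale (inverse q) (f b \<otimes>\<^bsub>R\<^esub> f a)) = \<one>\<^bsub>R\<^esub>"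
      using ker[OF that] unfolding q_weyl_def mult.assoc f_diff f_simps(3,4)
      by (simp only: f_simps(2) right_minus_eq)
    then have "mscale (q - inverse q) (mscale (1 / (q - inverse q))
        (mscale q (f a \<otimes>\<^bsub>R\<^esub> f b) - mscale (inverse q) (f b \<otimes>\<^bsub>R\<^esub> f a))) =
        mscale (q - inverse q) \<one>\<^bsub>R\<^esub>"
      by (rule arg_cong)
    then show ?thesis
      unfolding cmat.scale_scale using q by simp
  qed
  note rel = uq_relations[of q, unfolded insert_subset]
  show "f (gen GZ) \<otimes>\<^bsub>R\<^esub> f (gen GZinv) = \<one>\<^bsub>R\<^esub>" "f (gen GZinv) \<otimes>\<^bsub>R\<^esub> f (gen GZ) = \<one>\<^bsub>R\<^esub>"
    using ker[of "gen GZ * gen GZinv - 1"] ker[of "gen GZinv * gen GZ - 1"] rel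
    by (simp_all add: f_diff f_simps)
  show "mscale q (f (gen GZ) \<otimes>\<^bsub>R\<^esub> f (gen GX)) - mscale (inverse q) (f (gen GX) \<otimes>\<^bsub>R\<^esub> f (gen GZ)) =
      mscale (q - inverse q) \<one>\<^bsub>R\<^esub>"
    "mscale q (f (gen GY) \<otimes>\<^bsub>R\<^esub> f (gen GZ)) - mscale (inverse q) (f (gen GZ) \<otimes>\<^bsub>R\<^esub> f (gen GY)) =
      mscale (q - inverse q) \<one>\<^bsub>R\<^esub>"
    by (rule weyl, simp add: rel)+
qed

text \<open>It suffices to place the images of the four letters in \<open>K\<close>: that of
  \<open>z\<close> is given, its inverse follows by finite dimension, and \<open>x\<close> and
  \<open>y\<close> are separated by conjugation with \<open>z\<close>.\<close>

lemma uq_hom_image_in_subalgebra: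
  fixes X :: "'x set"
  defines "R \<equiv> End_alg X"
  assumes fin: "finite X" and K: "complex_subalgebra R K"
    and \<pi>: "\<pi> \<in> complex_alg_hom (uq q) R"
    and q: "q \<noteq> 0" "q ^ 4 \<noteq> 1"
    and z: "\<pi> (uq_z q) \<in> K"
    and c1: "c1 \<in> K" "d1 \<in> K" "d1 \<otimes>\<^bsub>R\<^esub> c1 = \<one>\<^bsub>R\<^esub>" "\<And>B. B \<in> K \<Longrightarrow> c1 \<otimes>\<^bsub>R\<^esub> B = B \<otimes>\<^bsub>R\<^esub> c1"
    and c2: "c2 \<in> K" "d2 \<in> K" "d2 \<otimes>\<^bsub>R\<^esub> c2 = \<one>\<^bsub>R\<^esub>" "\<And>B. B \<in> K \<Longrightarrow> c2 \<otimes>\<^bsub>R\<^esub> B = B \<otimes>\<^bsub>R\<^esub> c2"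
    and sum: "c1 \<otimes>\<^bsub>R\<^esub> \<pi> (uq_x q) + c2 \<otimes>\<^bsub>R\<^esub> \<pi> (uq_y q) \<in> K"
  shows "\<pi> ` carrier (uq q) \<subseteq> K"
proof -
  define f where "f = (\<lambda>a. \<pi> (uq_coset q a))"
  have f_apply: "\<pi> (uq_coset q a) = f a" for a
    by (simp add: f_def)
  have f: "f \<in> complex_alg_hom free_alg R"
    unfolding f_def using uq_coset_hom \<pi> by (rule complex_alg_hom_comp)
  have carr: "f a \<in> carrier R" for a
    using f by (auto simp: complex_alg_hom_def ring_hom_def free_alg_simps)
  have w: "q - inverse q \<noteq> 0"
  proof
    assume "q - inverse q = 0"
    then have "q * q = 1"
      using q(1) by (simp add: field_simps)
    then have "q ^ 4 = 1"
      by (simp add: numeral_eq_Suc)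
    with q(2) show False by simp
  qed
  note rel = uq_hom_relations[OF \<pi>[unfolded R_def] w, folded R_def, unfolded f_apply]
  have zK: "f (gen GZ) \<in> K"
    using z by (simp add: f_def uq_z_def)
  have sum': "c1 \<otimes>\<^bsub>R\<^esub> f (gen GX) + c2 \<otimes>\<^bsub>R\<^esub> f (gen GY) \<in> K"
    using sum by (simp only: f_def uq_x_def uq_y_def)
  have "f (gen GX) \<in> K" "f (gen GY) \<in> K"
    by (rule equitable_generators_in_subalgebra[OF fin, folded R_def,
          OF K zK carr rel(1,2) carr carr rel(3,4) q c1(1-3) c1(4)[OF zK] c2(1-3) c2(4)[OF zK] sum'])+
  moreover have "f (gen GZinv) \<in> K"
    using subalgebra_contains_inverse[OF fin K[unfolded R_def] zK] carr rel(2) by (simp add: R_def)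
  ultimately have "f (gen g) \<in> K" for g
    using zK by (cases g) simp_all
  then have "f a \<in> K" for a
    using free_alg_hom_in_subalgebra f K by (metis R_def)
  then show ?thesis
    by (auto simp: carrier_uq f_def)
qed

section \<open>The dual polar graph\<close>

lemma finite_dp_vertices:
  fixes scale :: "'k::{field,finite} \<Rightarrow> 'u::ab_group_add \<Rightarrow> 'u"
  assumes "polar_space scale \<phi> D e"
  shows "finite (dp_vertices scale \<phi>)"
proof -
  obtain B where "vector_space scale" "finite B" "module.span scale B = UNIV"
    using assms by (auto simp: polar_space_def)
  then have "finite (UNIV :: 'u set)"
    using vector_space.finite_span_of_finite[of scale B] by simp
  then have "finite (UNIV :: 'u set set)"
    by (simp add: Finite_Set.finite_set)
  then show ?thesis
    by (rule finite_subset[OF subset_UNIV])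
qed

text \<open>For \<open>b > 1\<close> all factors of numerators and denominators are nonzero. This
  allows the formulas for \<open>A\<close> and \<open>A'\<close> to be solved for the images of the
  generators.\<close>

lemma coefficients_nonzero:
  assumes "b > 1"
  shows "coef_kappa b D e \<noteq> 0" "coef_upsilon b D \<noteq> 0" "coef_kappastar b D e \<noteq> 0"
proof -
  have "b powr r + 1 > 0" "b powr r + b > 0" for r
    using assms by (smt (verit) powr_ge_zero)+
  then have "b powr r + 1 \<noteq> 0" "b powr r + b \<noteq> 0" for r
    by (metis less_irrefl)+
  then show "coef_kappa b D e \<noteq> 0" "coef_upsilon b D \<noteq> 0" "coef_kappastar b D e \<noteq> 0"
    using assms by (simp_all add: coef_kappa_def coef_upsilon_def coef_kappastar_def coef_xi_def
        power_int_eq_0_iff)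
qed

theorem theorem1p9:
  fixes scale :: "'k::{field,finite} \<Rightarrow> 'u::ab_group_add \<Rightarrow> 'u"
    and \<phi> :: "('k, 'u) form"
    and D :: nat and e :: real and q :: complex
    and x :: "'u set"
    and \<Upsilon> \<Psi> :: "'u set cmat"
    and \<pi> :: "uq_free set \<Rightarrow> 'u set cmat"
    and R :: "(complex, 'u set cmat) module"
  assumes "D \<ge> 3"
    and "polar_space scale \<phi> D e"
    and "x \<in> dp_vertices scale \<phi>"
    and "q = complex_of_real (sqrt (real CARD('k)))"
    and "R = End_alg (dp_vertices scale \<phi>)"
    and "is_Upsilon scale \<phi> D x q \<Upsilon>"
    and "is_Psi scale \<phi> D x q \<Psi>"
    and "dp_hom scale \<phi> D e x \<Upsilon> \<Psi> (uq_x q) (uq_y q) \<pi> \<or>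
         dp_hom scale \<phi> D e x \<Upsilon> \<Psi> (uq_y q) (uq_x q) \<pi>"
  shows "dp_T scale \<phi> D x =
    generated_algebra R (\<pi> ` carrier (uq q) \<union> {\<Upsilon>, inv\<^bsub>R\<^esub> \<Upsilon>, \<Psi>, inv\<^bsub>R\<^esub> \<Psi>})"
proof -

  \<comment> \<open>Notation and numerical facts\<close>
  define X where "X = dp_vertices scale \<phi>"
  define T where "T = dp_T scale \<phi> D x"
  define b where "b = real CARD('k)"
  define A where "A = dp_adj scale \<phi> D"
  define A' where "A' = dp_adj_dual scale \<phi> D x"
  define \<kappa> where "\<kappa> = complex_of_real (coef_kappa b D e)"
  define \<upsilon> where "\<upsilon> = complex_of_real (coef_upsilon b D)"
  define \<kappa>' where "\<kappa>' = complex_of_real (coef_kappastar b D e)"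
  define h where "h = complex_of_real (coef_h b e)"
  define h' where "h' = complex_of_real (coef_hstar b D e)"
  have R: "R = End_alg X"
    using assms(5) by (simp add: X_def)
  have fin: "finite X"
    unfolding X_def using assms(2) by (rule finite_dp_vertices)
  \<comment> \<open>The field contains 0 and 1, so \<open>b\<close> is at least 2.\<close>
  have "card {0, 1 :: 'k} \<le> CARD('k)"
    by (rule card_mono) simp_all
  then have b: "b > 1"
    by (simp add: b_def)
  have q0: "q \<noteq> 0"
    using b assms(4) by (simp add: b_def)
  have "q ^ 4 = complex_of_real (sqrt b ^ 4)"
    by (simp add: assms(4) b_def)
  also have "sqrt b ^ 4 = ((sqrt b)\<^sup>2)\<^sup>2"
    by (simp flip: power_mult)
  also have "\<dots> = b\<^sup>2"
    using b by simp
  finally have "q ^ 4 = complex_of_real (b\<^sup>2)" .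
  moreover have "b\<^sup>2 > 1"
    using b by (simp add: one_less_power)
  ultimately have q4: "q ^ 4 \<noteq> 1"
    by (metis less_irrefl of_real_eq_1_iff)
  have coef: "\<kappa> \<noteq> 0" "\<upsilon> \<noteq> 0" "\<kappa>' \<noteq> 0"
    using coefficients_nonzero[OF b] by (simp_all add: \<kappa>_def \<upsilon>_def \<kappa>'_def)
  have AA: "{A, A'} \<subseteq> carrier R"
    by (auto simp: R A_def A'_def End_alg_carrier dp_adj_def dp_adj_dual_def X_def)
  have T_gen: "T = generated_algebra R {A, A'}"
    by (simp add: T_def dp_T_def A_def A'_def R X_def)
  have sub_T: "complex_subalgebra R T"
    unfolding T_gen using AA complex_subalgebra_carrier[of X, folded R] by (rule complex_subalgebra_hull)
  note T = complex_subalgebra_closed[OF sub_T[unfolded R], folded R]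
  have AT: "A \<in> T" "A' \<in> T"
    by (auto simp: T_gen generated_algebra_def hull_inc)
  note one = End_alg_mult_one[OF fin, folded R]
  note assoc = End_alg_mult_assoc[where X = X, folded R]
  note lin = End_alg_mult_linear[where X = X, folded R]

  \<comment> \<open>The central elements and their inverses\<close>
  obtain f where \<Upsilon>: "central_q_power X T q f \<Upsilon>"
    using assms(6) unfolding is_Upsilon_def X_def T_def by blast
  obtain g where \<Psi>: "central_q_power X T q g \<Psi>"
    using assms(7) unfolding is_Psi_def X_def T_def by blast
  have \<Upsilon>T: "\<Upsilon> \<in> T" "\<And>B. B \<in> T \<Longrightarrow> \<Upsilon> \<otimes>\<^bsub>R\<^esub> B = B \<otimes>\<^bsub>R\<^esub> \<Upsilon>"
    using \<Upsilon> by (simp_all add: central_q_power_def R)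
  have \<Psi>T: "\<Psi> \<in> T" "\<And>B. B \<in> T \<Longrightarrow> \<Psi> \<otimes>\<^bsub>R\<^esub> B = B \<otimes>\<^bsub>R\<^esub> \<Psi>"
    using \<Psi> by (simp_all add: central_q_power_def R)
  note inv\<Upsilon> = central_q_power_inverse[OF fin sub_T[unfolded R] q0 \<Upsilon>, folded R]
  note inv\<Psi> = central_q_power_inverse[OF fin sub_T[unfolded R] q0 \<Psi>, folded R]
  have central: "M \<otimes>\<^bsub>R\<^esub> N \<otimes>\<^bsub>R\<^esub> B = B \<otimes>\<^bsub>R\<^esub> (M \<otimes>\<^bsub>R\<^esub> N)"
    if "B \<in> T" "M \<otimes>\<^bsub>R\<^esub> B = B \<otimes>\<^bsub>R\<^esub> M" "N \<otimes>\<^bsub>R\<^esub> B = B \<otimes>\<^bsub>R\<^esub> N" for B M N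
    using that by (metis assoc)
  have cancel: "M \<otimes>\<^bsub>R\<^esub> N \<otimes>\<^bsub>R\<^esub> (N' \<otimes>\<^bsub>R\<^esub> M') = \<one>\<^bsub>R\<^esub>"
    if "N \<otimes>\<^bsub>R\<^esub> N' = \<one>\<^bsub>R\<^esub>" "M \<otimes>\<^bsub>R\<^esub> M' = \<one>\<^bsub>R\<^esub>" "M' \<in> T" for M N M' N'
    using that one(1)[OF T(6)] by (metis assoc)
  \<comment> \<open>\<open>c1\<close> and \<open>c2\<close> are the coefficients of
    \<open>\<pi> g1\<close> and \<open>\<pi> g2\<close> in the formula for \<open>A\<close>;
    \<open>d1\<close> and \<open>d2\<close> are their inverses, with the factors reversed.\<close>
  define c1 where "c1 = mscale \<kappa> (inv\<^bsub>R\<^esub> \<Upsilon> \<otimes>\<^bsub>R\<^esub> \<Psi>)"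
  define d1 where "d1 = mscale (1 / \<kappa>) (inv\<^bsub>R\<^esub> \<Psi> \<otimes>\<^bsub>R\<^esub> \<Upsilon>)"
  define c2 where "c2 = mscale \<upsilon> (\<Upsilon> \<otimes>\<^bsub>R\<^esub> inv\<^bsub>R\<^esub> \<Psi>)"
  define d2 where "d2 = mscale (1 / \<upsilon>) (\<Psi> \<otimes>\<^bsub>R\<^esub> inv\<^bsub>R\<^esub> \<Upsilon>)"
  have cT: "c1 \<in> T" "d1 \<in> T" "c2 \<in> T" "d2 \<in> T"
    unfolding c1_def d1_def c2_def d2_def
    by (intro T(2,3) \<Upsilon>T(1) \<Psi>T(1) inv\<Upsilon>(1) inv\<Psi>(1))+
  have dc: "d1 \<otimes>\<^bsub>R\<^esub> c1 = \<one>\<^bsub>R\<^esub>" "d2 \<otimes>\<^bsub>R\<^esub> c2 = \<one>\<^bsub>R\<^esub>"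
    using coef cancel[OF inv\<Upsilon>(3) inv\<Psi>(2) \<Psi>T(1)] cancel[OF inv\<Upsilon>(2) inv\<Psi>(3) inv\<Psi>(1)]
    by (simp_all add: c1_def d1_def c2_def d2_def lin)
  have comm: "c1 \<otimes>\<^bsub>R\<^esub> B = B \<otimes>\<^bsub>R\<^esub> c1" "c2 \<otimes>\<^bsub>R\<^esub> B = B \<otimes>\<^bsub>R\<^esub> c2" if "B \<in> T" for B
    using central[OF that inv\<Upsilon>(4)[OF that] \<Psi>T(2)[OF that]]
      central[OF that \<Upsilon>T(2)[OF that] inv\<Psi>(4)[OF that]]
    by (simp_all add: c1_def c2_def lin)

  \<comment> \<open>The image of the quantum algebra lies in \<open>T\<close>\<close>
  define G where "G = \<pi> ` carrier (uq q) \<union> {\<Upsilon>, inv\<^bsub>R\<^esub> \<Upsilon>, \<Psi>, inv\<^bsub>R\<^esub> \<Psi>}"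
  define K where "K = generated_algebra R G"
  \<comment> \<open>Covers both homomorphisms at once; they differ only in which of \<open>x\<close>
    and \<open>y\<close> is \<open>g1\<close>.\<close>
  obtain g1 g2 where g: "(g1, g2) = (uq_x q, uq_y q) \<or> (g1, g2) = (uq_y q, uq_x q)"
    and hom: "dp_hom scale \<phi> D e x \<Upsilon> \<Psi> g1 g2 \<pi>"
    using assms(8) by blast
  have \<pi>: "\<pi> \<in> complex_alg_hom (uq q) R"
    and A: "A = mscale h \<one>\<^bsub>R\<^esub> + c1 \<otimes>\<^bsub>R\<^esub> \<pi> g1 + c2 \<otimes>\<^bsub>R\<^esub> \<pi> g2"
    and A': "A' = mscale h' \<one>\<^bsub>R\<^esub> + mscale \<kappa>' (inv\<^bsub>R\<^esub> \<Upsilon> \<otimes>\<^bsub>R\<^esub> inv\<^bsub>R\<^esub> \<Psi> \<otimes>\<^bsub>R\<^esub> \<pi> (uq_z q))"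
    using hom
    unfolding dp_hom_def Let_def b_def[symmetric] assms(4)[folded b_def, symmetric]
      X_def[symmetric] A_def[symmetric] A'_def[symmetric] R[symmetric]
      \<kappa>_def[symmetric] \<upsilon>_def[symmetric] \<kappa>'_def[symmetric] h_def[symmetric] h'_def[symmetric]
    by (simp_all only: c1_def c2_def lin End_alg_simps[where X = X, folded R])
  have carr: "\<pi> g \<in> carrier R" if "g \<in> carrier (uq q)" for g
    using \<pi> that by (auto simp: complex_alg_hom_def ring_hom_def)
  have gens: "uq_x q \<in> carrier (uq q)" "uq_y q \<in> carrier (uq q)" "uq_z q \<in> carrier (uq q)"
    by (auto simp: carrier_uq uq_x_def uq_y_def uq_z_def)
  define u where "u = \<pi> (uq_z q)"
  have u: "u \<in> carrier R"
    unfolding u_def by (rule carr) (rule gens)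
  \<comment> \<open>The formula for \<open>A'\<close> is solved for the image of \<open>z\<close> by
    multiplying with \<open>\<Upsilon>\<close>, then \<open>\<Psi>\<close>, and dividing by
    \<open>\<kappa>'\<close>.\<close>
  have "A' - mscale h' \<one>\<^bsub>R\<^esub> = mscale \<kappa>' (inv\<^bsub>R\<^esub> \<Upsilon> \<otimes>\<^bsub>R\<^esub> (inv\<^bsub>R\<^esub> \<Psi> \<otimes>\<^bsub>R\<^esub> u))"
    by (simp add: A' u_def assoc)
  then have "mscale (1 / \<kappa>') (\<Psi> \<otimes>\<^bsub>R\<^esub> (\<Upsilon> \<otimes>\<^bsub>R\<^esub> (A' - mscale h' \<one>\<^bsub>R\<^esub>))) =
      (\<Psi> \<otimes>\<^bsub>R\<^esub> \<Upsilon>) \<otimes>\<^bsub>R\<^esub> (inv\<^bsub>R\<^esub> \<Upsilon> \<otimes>\<^bsub>R\<^esub> inv\<^bsub>R\<^esub> \<Psi>) \<otimes>\<^bsub>R\<^esub> u"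
    using coef by (simp add: lin assoc)
  also have "\<dots> = u"
    using cancel[OF inv\<Upsilon>(3) inv\<Psi>(3) inv\<Psi>(1)] one(1)[OF u] by simp
  finally have "u = mscale (1 / \<kappa>') (\<Psi> \<otimes>\<^bsub>R\<^esub> (\<Upsilon> \<otimes>\<^bsub>R\<^esub> (A' - mscale h' \<one>\<^bsub>R\<^esub>)))" ..
  also have "\<dots> \<in> T"
    by (intro T(2,3,4,5) \<Psi>T(1) \<Upsilon>T(1) AT)
  finally have zT: "\<pi> (uq_z q) \<in> T"
    by (simp add: u_def)
  have "c1 \<otimes>\<^bsub>R\<^esub> \<pi> g1 + c2 \<otimes>\<^bsub>R\<^esub> \<pi> g2 = A - mscale h \<one>\<^bsub>R\<^esub>"
    by (simp add: A)
  also have "\<dots> \<in> T"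
    by (intro T(3,4,5) AT)
  finally have sum: "c1 \<otimes>\<^bsub>R\<^esub> \<pi> g1 + c2 \<otimes>\<^bsub>R\<^esub> \<pi> g2 \<in> T" .
  note image = uq_hom_image_in_subalgebra[OF fin sub_T[unfolded R] \<pi>[unfolded R] q0 q4 zT, folded R]
  have "\<pi> ` carrier (uq q) \<subseteq> T"
    using g
  proof
    assume "(g1, g2) = (uq_x q, uq_y q)"
    then show ?thesis
      using image[of c1 d1 c2 d2] cT dc comm sum by simp
  next
    assume "(g1, g2) = (uq_y q, uq_x q)"
    then show ?thesis
      \<comment> \<open>Here \<open>x\<close> carries the coefficient \<open>c2\<close>, so the two
        pairs change places.\<close>
      using image[of c2 d2 c1 d1] cT dc comm sum by (simp add: add.commute)
  qed
  then have GT: "G \<subseteq> T"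
    using \<Upsilon>T(1) \<Psi>T(1) inv\<Upsilon>(1) inv\<Psi>(1) by (simp add: G_def)

  \<comment> \<open>Equality of \<open>T\<close> with the generated algebra\<close>
  have "complex_subalgebra R K"
    unfolding K_def
  proof (rule complex_subalgebra_hull)
    show "G \<subseteq> carrier R"
      using GT T(6) by blast
  qed (simp add: R complex_subalgebra_carrier)
  note K = this complex_subalgebra_closed[OF this[unfolded R], folded R]
  have "G \<subseteq> K"
    by (simp add: K_def generated_algebra_def hull_subset)
  then have GK: "\<Upsilon> \<in> K" "inv\<^bsub>R\<^esub> \<Upsilon> \<in> K" "\<Psi> \<in> K" "inv\<^bsub>R\<^esub> \<Psi> \<in> K"
    "\<pi> (uq_z q) \<in> K" "\<pi> g1 \<in> K" "\<pi> g2 \<in> K"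
    using gens g by (auto simp: G_def)
  have "A \<in> K" "A' \<in> K"
    unfolding A A' c1_def c2_def by (intro K(2-6) GK)+
  then have "T \<subseteq> K"
    unfolding T_gen generated_algebra_def by (intro hull_minimal K(1)) simp
  moreover have "K \<subseteq> T"
    unfolding K_def generated_algebra_def using GT sub_T by (rule hull_minimal)
  ultimately show ?thesis
    by (simp add: T_def K_def G_def)
qed

end
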